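(* Let $\mathcal{H}$ be a separable Hilbert space, let $\{v_i\}_{i\in I}$ and $\{w_i\}_{i\in I}$ be two Riesz bases of $\mathcal{H}$, and let $A=(a_{i,j})_{i,j\in I}$ be the change of basis matrix from $\{v_i\}_{i\in I}$ to $\{w_i\}_{i\in I}$. Then $\{v_i\}_{i\in I}$ and $\{w_i\}_{i\in I}$ are woven if and only if all central sub-matrices of $A$ define uniformly bounded invertible operators, i.e. there exist constants $C_1,C_2>0$ such that $$C_1\|\alpha\|_{\ell^2(J)}^2\le\|A_J\alpha\|_{\ell^2(J)}^2\le C_2\|\alpha\|_{\ell^2(J)}^2$$ for every $J\subset I$ and every $\alpha\in\ell^2(J)$.
   Context: Hilbert spaces are over $\mathbb{C}$ and $I$ is a countable index set. A family $\{v_i\}_{i\in I}$ in $\mathcal{H}$ is a frame if there are constants $a,b>0$ with $a\|f\|^2\le\sum_{i\in I}|\langle f,v_i\rangle|^2\le b\|f\|^2$ for all $f\in\mathcal{H}$. It is a Riesz sequence if there are constants $a,b>0$ with $a\|c\|_2\le\|\sum_{i\in I}c_iv_i\|\le b\|c\|_2$ for all finitely supported coefficient sequences $c=(c_i)_{i\in I}$, and a Riesz basis if in addition it is a frame. Two frames $\{v_i\}_{i\in I}$ and $\{w_i\}_{i\in I}$ are woven if for every $J\subset I$ the indexed family $\{v_i\}_{i\in J}\cup\{w_i\}_{i\in I\setminus J}$ is a frame of $\mathcal{H}$. The change of basis matrix from the Riesz basis $\{v_i\}_{i\in I}$ to the Riesz basis $\{w_i\}_{i\in I}$ is the matrix $A=(a_{i,j})_{i,j\in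 I}$ with $w_i=\sum_{j\in I}a_{j,i}v_j$ for each $i\in I$ (it defines a bounded invertible operator on $\ell^2(I)$). The central sub-matrices of $A$ are the matrices $A_J:=(a_{i,j})_{i,j\in J}$ with $J$ any subset of $I$. *)

theory Defs
  imports "HOL-Analysis.Analysis"
begin

text \<open>Complex Hilbert spaces. The inner product is linear in the first argument and conjugate
  linear in the second.\<close>

class complex_vector = real_vector +
  fixes scaleC :: "complex \<Rightarrow> 'a \<Rightarrow> 'a"
  assumes scaleC_add_right: "scaleC c (x + y) = scaleC c x + scaleC c y"
    and scaleC_add_left: "scaleC (c + d) x = scaleC c x + scaleC d x"
    and scaleC_scaleC: "scaleC c (scaleC d x) = scaleC (c * d) x"
    and scaleC_one: "scaleC 1 x = x"
    and scaleR_scaleC: "scaleR r x = scaleC (complex_of_real r) x"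

class complex_inner = complex_vector + real_normed_vector +
  fixes cinner :: "'a \<Rightarrow> 'a \<Rightarrow> complex"
  assumes cinner_commute: "cinner x y = cnj (cinner y x)"
    and cinner_add_left: "cinner (x + y) z = cinner x z + cinner y z"
    and cinner_scaleC_left: "cinner (scaleC c x) y = c * cinner x y"
    and cinner_self_nonneg: "0 \<le> Re (cinner x x)"
    and cinner_eq_zero_iff: "cinner x x = 0 \<longleftrightarrow> x = 0"
    and norm_eq_sqrt_cinner: "norm x = sqrt (Re (cinner x x))"

class complex_hilbert_space = complex_inner + complete_space

instantiation complex :: complex_hilbert_space
begin

definition "scaleC (c :: complex) x = c * (x :: complex)"

definition "cinner (x :: complex) y = x * cnj y"

instance
  by standard
    (auto simp: scaleC_complex_def cinner_complex_def algebra_simps scaleR_conv_of_real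
      norm_complex_def power2_eq_square)

end

text \<open>Families indexed by a set \<open>I\<close> are total functions of which only the values on \<open>I\<close> matter.
  The same convention applies to members of \<open>ell2 I\<close>. Since \<open>infsum\<close> is \<open>0\<close> on non-summable
  functions, summability is required explicitly wherever it is part of the meaning.\<close>

definition is_frame :: "'i set \<Rightarrow> ('i \<Rightarrow> 'a::complex_hilbert_space) \<Rightarrow> bool" where
  "is_frame I v \<longleftrightarrow> (\<exists>a>0. \<exists>b>0. \<forall>f.
     (\<lambda>i. (cmod (cinner f (v i)))\<^sup>2) summable_on I \<and>
     a * (norm f)\<^sup>2 \<le> (\<Sum>\<^sub>\<infinity>i\<in>I. (cmod (cinner f (v i)))\<^sup>2) \<and>
     (\<Sum>\<^sub>\<infinity>i\<in>I. (cmod (cinner f (v i)))\<^sup>2) \<le> b * (norm f)\<^sup>2)"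

definition ell2 :: "'i set \<Rightarrow> ('i \<Rightarrow> complex) set" where
  "ell2 I = {c. (\<lambda>i. (cmod (c i))\<^sup>2) summable_on I}"

definition ell2_norm :: "'i set \<Rightarrow> ('i \<Rightarrow> complex) \<Rightarrow> real" where
  "ell2_norm I c = sqrt (\<Sum>\<^sub>\<infinity>i\<in>I. (cmod (c i))\<^sup>2)"

definition is_riesz_sequence :: "'i set \<Rightarrow> ('i \<Rightarrow> 'a::complex_hilbert_space) \<Rightarrow> bool" where
  "is_riesz_sequence I v \<longleftrightarrow> (\<exists>a>0. \<exists>b>0. \<forall>c. finite {i\<in>I. c i \<noteq> 0} \<longrightarrow>
     a * ell2_norm I c \<le> norm (\<Sum>i\<in>{i\<in>I. c i \<noteq> 0}. scaleC (c i) (v i)) \<and>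
     norm (\<Sum>i\<in>{i\<in>I. c i \<noteq> 0}. scaleC (c i) (v i)) \<le> b * ell2_norm I c)"

definition is_riesz_basis :: "'i set \<Rightarrow> ('i \<Rightarrow> 'a::complex_hilbert_space) \<Rightarrow> bool" where
  "is_riesz_basis I v \<longleftrightarrow> is_riesz_sequence I v \<and> is_frame I v"

definition woven ::
    "'i set \<Rightarrow> ('i \<Rightarrow> 'a::complex_hilbert_space) \<Rightarrow> ('i \<Rightarrow> 'a) \<Rightarrow> bool" where
  "woven I v w \<longleftrightarrow> is_frame I v \<and> is_frame I w \<and>
     (\<forall>J\<subseteq>I. is_frame I (\<lambda>i. if i \<in> J then v i else w i))"

text \<open>Column \<open>i\<close> of \<open>A\<close> holds the coordinates of \<open>w i\<close> with respect to \<open>v\<close>; for Riesz bases this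
  determines the entries of \<open>A\<close> on \<open>I \<times> I\<close>.\<close>

definition is_change_of_basis_matrix ::
    "'i set \<Rightarrow> ('i \<Rightarrow> 'a::complex_hilbert_space) \<Rightarrow> ('i \<Rightarrow> 'a) \<Rightarrow> ('i \<Rightarrow> 'i \<Rightarrow> complex) \<Rightarrow> bool"
  where
  "is_change_of_basis_matrix I v w A \<longleftrightarrow>
     (\<forall>i\<in>I. ((\<lambda>j. scaleC (A j i) (v j)) has_sum w i) I)"

text \<open>The action of the central sub-matrix \<open>(A i j)\<close>, \<open>i, j \<in> J\<close>, on a sequence indexed by \<open>J\<close>.\<close>

definition central_mult ::
    "('i \<Rightarrow> 'i \<Rightarrow> complex) \<Rightarrow> 'i set \<Rightarrow> ('i \<Rightarrow> complex) \<Rightarrow> 'i \<Rightarrow> complex" where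
  "central_mult A J \<alpha> = (\<lambda>i. \<Sum>\<^sub>\<infinity>j\<in>J. A i j * \<alpha> j)"

text \<open>The two conditions before the inequalities say that \<open>A\<^sub>J \<alpha>\<close> is well defined and lies in
  \<open>ell2 J\<close>.\<close>

definition central_submatrices_unif_bdd_invertible ::
    "'i set \<Rightarrow> ('i \<Rightarrow> 'i \<Rightarrow> complex) \<Rightarrow> bool" where
  "central_submatrices_unif_bdd_invertible I A \<longleftrightarrow> (\<exists>C1>0. \<exists>C2>0. \<forall>J\<subseteq>I. \<forall>\<alpha>\<in>ell2 J.
     (\<forall>i\<in>J. (\<lambda>j. A i j * \<alpha> j) summable_on J) \<and>
     central_mult A J \<alpha> \<in> ell2 J \<and>
     C1 * (ell2_norm J \<alpha>)\<^sup>2 \<le> (ell2_norm J (central_mult A J \<alpha>))\<^sup>2 \<and>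
     (ell2_norm J (central_mult A J \<alpha>))\<^sup>2 \<le> C2 * (ell2_norm J \<alpha>)\<^sup>2)"

end

theory Submission
  imports Defs "HOL-Complex_Analysis.Great_Picard" "HOL-Library.Function_Algebras"
begin

text \<open>
  Identify \<open>f\<close> with its coefficient sequence \<open>x = (\<langle>f, v\<^sub>i\<rangle>)\<^sub>i\<close>. Since \<open>v\<close> is a Riesz basis, this is
  a bounded bijection onto \<open>\<ell>\<^sup>2(I)\<close> with bounded inverse, and \<open>w\<^sub>i = \<Sum>\<^sub>j a\<^sub>j\<^sub>i v\<^sub>j\<close> turns the coefficients
  along \<open>w\<close> into \<open>A\<^sup>* x\<close>. For \<open>K = I - J\<close> the weaving that takes \<open>v\<close> on \<open>J\<close> and \<open>w\<close> on \<open>K\<close> therefore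
  measures \<open>x\<close> on \<open>J\<close> and \<open>A\<^sup>* x\<close> on \<open>K\<close>. As \<open>x\<close> is already controlled on \<open>J\<close>, this weaving is a frame
  exactly if the compression \<open>(A\<^sub>K)\<^sup>*\<close> of \<open>A\<^sup>*\<close> to \<open>\<ell>\<^sup>2(K)\<close> is bounded below.

  Two gaps remain. First, the adjoints have to be exchanged for the matrices \<open>A\<^sub>K\<close> themselves. For a
  single infinite \<open>K\<close> a lower bound of \<open>(A\<^sub>K)\<^sup>*\<close> need not give one of \<open>A\<^sub>K\<close>, but for finite \<open>K\<close> the
  two have the same lower bounds, because a square matrix and its adjoint have inverses of the same
  norm (\<open>matrix_lower_adjoint\<close>). Bounds that are uniform over all finite \<open>K\<close> extend to infinite \<open>K\<close>
  by approximation (\<open>lower_bound_limit\<close>), since \<open>A\<close> is bounded.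

  Second, this detour needs one lower bound for all \<open>K\<close>, while being woven only provides a lower
  frame bound for each weaving separately. The bounds can be chosen uniformly for any two frames over
  a countable index set all of whose weavings are frames (\<open>weaving_uniform_lower_bound\<close>): otherwise
  there are unit vectors, weakly convergent to zero, that are nearly annihilated by some weavings,
  and a gliding hump combines these weavings into one without a lower frame bound.

  Both the weak limits and the dual basis of \<open>v\<close> come from the surjectivity of the frame operator
  (\<open>frame_operator_surj\<close>), which follows from a contraction argument.
\<close>

section \<open>Inner products and square-summable families\<close>

instance complex_hilbert_space \<subseteq> banach ..

lemma cinner_add_right: "cinner x (y + z) = cinner x y + cinner x z"
  by (metis cinner_add_left cinner_commute complex_cnj_add)

lemma cinner_scaleC_right: "cinner x (scaleC c y) = cnj c * cinner x y"
  by (metis cinner_commute cinner_scaleC_left complex_cnj_mult)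

lemma cinner_scaleR_left: "cinner (r *\<^sub>R x) y = r *\<^sub>R cinner x y"
  by (simp add: scaleR_scaleC[of r x] cinner_scaleC_left scaleR_conv_of_real)

lemma cinner_scaleR_right: "cinner x (r *\<^sub>R y) = r *\<^sub>R cinner x y"
  by (simp add: scaleR_scaleC[of r y] cinner_scaleC_right scaleR_conv_of_real)

lemma cinner_self: "cinner x x = complex_of_real ((norm x)\<^sup>2)"
proof (rule complex_eqI)
  show "Re (cinner x x) = Re (complex_of_real ((norm x)\<^sup>2))"
    using cinner_self_nonneg[of x] by (simp add: norm_eq_sqrt_cinner)
  have "Im (cinner x x) = - Im (cinner x x)"
    by (metis cinner_commute cnj.simps(2))
  then show "Im (cinner x x) = Im (complex_of_real ((norm x)\<^sup>2))" by simp
qed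

lemma norm_scaleC: "norm (scaleC c x) = cmod c * norm (x :: 'a :: complex_inner)"
proof -
  have "complex_of_real ((norm (scaleC c x))\<^sup>2) = c * cnj c * complex_of_real ((norm x)\<^sup>2)"
    unfolding cinner_self[symmetric] by (simp add: cinner_scaleC_left cinner_scaleC_right)
  also have "\<dots> = complex_of_real ((cmod c * norm x)\<^sup>2)"
    by (simp only: complex_norm_square[symmetric] power_mult_distrib of_real_mult)
  finally have "(norm (scaleC c x))\<^sup>2 = (cmod c * norm x)\<^sup>2"
    by (simp only: of_real_eq_iff)
  then show ?thesis by simp
qed

lemma norm_add_squared: "(norm (x + y))\<^sup>2 = (norm x)\<^sup>2 + 2 * Re (cinner x y) + (norm y)\<^sup>2"
proof -
  have "(norm z)\<^sup>2 = Re (cinner z z)" for z :: 'a by (simp add: cinner_self)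
  moreover have "Re (cinner y x) = Re (cinner x y)"
    by (metis cinner_commute cnj.simps(1))
  ultimately show ?thesis
    by (simp add: cinner_add_left cinner_add_right)
qed

text \<open>The norm is already known to satisfy the triangle inequality, so squaring that inequality
  bounds the real part of the inner product; a rotation of one argument turns the real part into
  the modulus.\<close>

lemma cauchy_schwarz: "cmod (cinner x y) \<le> norm x * norm (y :: 'a :: complex_inner)"
proof -
  have re: "Re (cinner z y) \<le> norm z * norm y" for z :: 'a
  proof -
    have "(norm (z + y))\<^sup>2 \<le> (norm z + norm y)\<^sup>2"
      by (simp add: norm_triangle_ineq power_mono)
    then show ?thesis unfolding norm_add_squared by (simp add: power2_sum)
  qed
  show ?thesis
  proof (cases "cinner x y = 0")
    case False
    define u where "u = cnj (sgn (cinner x y))"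
    have u: "cmod u = 1" using False by (simp add: u_def norm_sgn)
    have "u * cinner x y = complex_of_real (cmod (cinner x y))"
      using False complex_norm_square[of "cinner x y"]
      by (simp add: u_def sgn_div_norm scaleR_conv_of_real field_simps power2_eq_square)
    then have "cmod (cinner x y) = Re (cinner (scaleC u x) y)"
      by (simp add: cinner_scaleC_left)
    then show ?thesis using re[of "scaleC u x"] by (simp add: norm_scaleC u)
  qed simp
qed

lemma bounded_linear_cinner_left: "bounded_linear (\<lambda>x. cinner x (y :: 'a :: complex_inner))"
  by (rule bounded_linear_intro[of _ "norm y"])
    (auto simp: cinner_add_left cinner_scaleR_left cauchy_schwarz)

lemma bounded_linear_cinner_right: "bounded_linear (\<lambda>y. cinner (x :: 'a :: complex_inner) y)"
proof (rule bounded_linear_intro[of _ "norm x"])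
  show "norm (cinner x y) \<le> norm y * norm x" for y
    using cauchy_schwarz[of x y] by (simp only: mult.commute)
qed (simp_all add: cinner_add_right cinner_scaleR_right)

lemmas cinner_diff_left = linear_diff[OF bounded_linear.linear[OF bounded_linear_cinner_left]]
  and cinner_sum_left = linear_sum[OF bounded_linear.linear[OF bounded_linear_cinner_left]]
  and cinner_zero_left = linear_0[OF bounded_linear.linear[OF bounded_linear_cinner_left]]

lemma scaleC_zero_left: "scaleC 0 x = (0 :: 'a :: complex_inner)"
  using norm_scaleC[of 0 x] by simp

lemma scaleC_diff_left: "scaleC (c - d) x = scaleC c x - scaleC d (x :: 'a :: complex_inner)"
  by (metis add_diff_cancel_right' diff_add_cancel scaleC_add_left)

lemma L2_set_squared: "(L2_set f F)\<^sup>2 = (\<Sum>i\<in>F. (f i)\<^sup>2)"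
  by (simp add: L2_set_def sum_nonneg)

lemma L2_set_le_iff: "0 \<le> c \<Longrightarrow> L2_set f F \<le> c \<longleftrightarrow> (\<Sum>i\<in>F. (f i)\<^sup>2) \<le> c\<^sup>2"
  unfolding L2_set_squared[symmetric] by (simp add: power_mono_iff)

lemma L2_set_cmod_add_le:
  "L2_set (\<lambda>i. cmod (x i + y i)) F \<le> L2_set (\<lambda>i. cmod (x i)) F + L2_set (\<lambda>i. cmod (y i)) F"
proof -
  have "L2_set (\<lambda>i. cmod (x i + y i)) F \<le> L2_set (\<lambda>i. cmod (x i) + cmod (y i)) F"
    by (rule L2_set_mono) (auto intro: norm_triangle_ineq)
  also have "\<dots> \<le> L2_set (\<lambda>i. cmod (x i)) F + L2_set (\<lambda>i. cmod (y i)) F"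
    by (rule L2_set_triangle_ineq)
  finally show ?thesis .
qed

lemma cmod_sum_mult_le:
  "cmod (\<Sum>i\<in>F. x i * y i) \<le> L2_set (\<lambda>i. cmod (x i)) F * L2_set (\<lambda>i. cmod (y i)) F"
proof -
  have "cmod (\<Sum>i\<in>F. x i * y i) \<le> (\<Sum>i\<in>F. \<bar>cmod (x i)\<bar> * \<bar>cmod (y i)\<bar>)"
    by (rule order_trans[OF norm_sum]) (simp add: norm_mult)
  also have "\<dots> \<le> L2_set (\<lambda>i. cmod (x i)) F * L2_set (\<lambda>i. cmod (y i)) F"
    by (rule L2_set_mult_ineq)
  finally show ?thesis .
qed

lemma nonneg_infsum_le:
  fixes g :: "'i \<Rightarrow> real"
  assumes "\<And>i. i \<in> I \<Longrightarrow> 0 \<le> g i" and "\<And>F. finite F \<Longrightarrow> F \<subseteq> I \<Longrightarrow> sum g F \<le> c"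
  shows "g summable_on I" and "infsum g I \<le> c"
proof -
  show s: "g summable_on I"
    using assms by (intro nonneg_bdd_above_summable_on bdd_aboveI[of _ c]) auto
  show "infsum g I \<le> c"
    using assms by (intro infsum_le_finite_sums s) auto
qed

lemma ell2_norm_squared: "(ell2_norm I x)\<^sup>2 = (\<Sum>\<^sub>\<infinity>i\<in>I. (cmod (x i))\<^sup>2)"
  by (simp add: ell2_norm_def infsum_nonneg)

lemma ell2_norm_nonneg: "0 \<le> ell2_norm I x"
  by (simp add: ell2_norm_def infsum_nonneg)

lemma ell2_finite_sum_le:
  assumes "x \<in> ell2 I" "finite F" "F \<subseteq> I"
  shows "(\<Sum>i\<in>F. (cmod (x i))\<^sup>2) \<le> (ell2_norm I x)\<^sup>2"
  unfolding ell2_norm_squared using assms by (intro finite_sum_le_infsum) (auto simp: ell2_def)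

lemma ell2_mono: "x \<in> ell2 I \<Longrightarrow> J \<subseteq> I \<Longrightarrow> x \<in> ell2 J"
  by (auto simp: ell2_def intro: summable_on_subset)

lemma ell2_cutoff:
  assumes "x \<in> ell2 J" "J \<subseteq> I"
  shows "(\<lambda>i. if i \<in> J then x i else 0) \<in> ell2 I"
    and "ell2_norm I (\<lambda>i. if i \<in> J then x i else 0) = ell2_norm J x"
proof -
  have "((\<lambda>i. (cmod (if i \<in> J then x i else 0))\<^sup>2) summable_on I)
      \<longleftrightarrow> (\<lambda>i. (cmod (x i))\<^sup>2) summable_on J"
    using assms by (intro summable_on_cong_neutral) auto
  then show "(\<lambda>i. if i \<in> J then x i else 0) \<in> ell2 I"
    using assms by (simp add: ell2_def)
  have "infsum (\<lambda>i. (cmod (if i \<in> J then x i else 0))\<^sup>2) I = infsum (\<lambda>i. (cmod (x i))\<^sup>2) J"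
    using assms by (intro infsum_cong_neutral) auto
  then show "ell2_norm I (\<lambda>i. if i \<in> J then x i else 0) = ell2_norm J x"
    by (simp add: ell2_norm_def)
qed

lemma ell2_norm_finite: "finite F \<Longrightarrow> ell2_norm F x = L2_set (\<lambda>i. cmod (x i)) F"
  by (simp add: ell2_norm_def L2_set_def)

lemma ell2_finite: "finite F \<Longrightarrow> x \<in> ell2 F"
  by (simp add: ell2_def)

lemma ell2_norm_cong: "(\<And>i. i \<in> I \<Longrightarrow> x i = y i) \<Longrightarrow> ell2_norm I x = ell2_norm I y"
  by (simp add: ell2_norm_def cong: infsum_cong)

lemma ell2_norm_split:
  assumes "x \<in> ell2 I" "J \<subseteq> I"
  shows "(ell2_norm I x)\<^sup>2 = (ell2_norm J x)\<^sup>2 + (ell2_norm (I - J) x)\<^sup>2"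
proof -
  have "I = J \<union> (I - J)" using assms(2) by auto
  then have "(ell2_norm I x)\<^sup>2 = infsum (\<lambda>i. (cmod (x i))\<^sup>2) (J \<union> (I - J))"
    by (simp add: ell2_norm_squared)
  also have "\<dots> = (ell2_norm J x)\<^sup>2 + (ell2_norm (I - J) x)\<^sup>2"
    unfolding ell2_norm_squared
    using ell2_mono[OF assms] ell2_mono[OF assms(1), of "I - J"]
    by (intro infsum_Un_disjoint) (auto simp: ell2_def)
  finally show ?thesis .
qed

lemma ell2_tail:
  assumes "x \<in> ell2 I" "0 < e"
  obtains F where "finite F" "F \<subseteq> I" "\<And>G. finite G \<Longrightarrow> G \<subseteq> I - F \<Longrightarrow> (\<Sum>i\<in>G. (cmod (x i))\<^sup>2) < e"
proof -
  let ?q = "\<lambda>i. (cmod (x i))\<^sup>2"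
  have s: "?q summable_on I" using assms by (simp add: ell2_def)
  obtain F where F: "finite F" "F \<subseteq> I" "dist (sum ?q F) (infsum ?q I) \<le> e / 2"
    using infsum_finite_approximation[OF s, of "e / 2"] assms(2) by auto
  show ?thesis
  proof (rule that[OF F(1,2)])
    fix G assume G: "finite G" "G \<subseteq> I - F"
    have "sum ?q (F \<union> G) \<le> infsum ?q I"
      using F G by (intro finite_sum_le_infsum s) auto
    moreover have "sum ?q (F \<union> G) = sum ?q F + sum ?q G"
      using F G by (intro sum.union_disjoint) auto
    ultimately show "sum ?q G < e"
      using F(3) assms(2) unfolding dist_real_def by linarith
  qed
qed

section \<open>Synthesis and the frame operator\<close>

text \<open>The upper frame bound, stated through finite partial sums so that summability of the
  coefficients is a consequence and not part of the condition.\<close>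

definition bessel :: "'i set \<Rightarrow> ('i \<Rightarrow> 'a::complex_hilbert_space) \<Rightarrow> real \<Rightarrow> bool" where
  "bessel I v b \<longleftrightarrow> 0 < b \<and>
     (\<forall>f F. finite F \<and> F \<subseteq> I \<longrightarrow> (\<Sum>i\<in>F. (cmod (cinner f (v i)))\<^sup>2) \<le> b * (norm f)\<^sup>2)"

lemma besselD:
  assumes "bessel I v b" "finite F" "F \<subseteq> I"
  shows "(\<Sum>i\<in>F. (cmod (cinner f (v i)))\<^sup>2) \<le> b * (norm f)\<^sup>2"
  using assms by (auto simp: bessel_def)

lemma bessel_pos: "bessel I v b \<Longrightarrow> 0 < b"
  by (simp add: bessel_def)

lemma bessel_L2_set_le:
  assumes "bessel I v b" "finite F" "F \<subseteq> I"
  shows "L2_set (\<lambda>i. cmod (cinner f (v i))) F \<le> sqrt b * norm f"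
  using besselD[OF assms, of f] bessel_pos[OF assms(1)]
  by (simp add: L2_set_le_iff power_mult_distrib)

lemma bessel_coeffs_ell2:
  assumes "bessel I v b"
  shows "(\<lambda>i. cinner f (v i)) \<in> ell2 I"
    and "(ell2_norm I (\<lambda>i. cinner f (v i)))\<^sup>2 \<le> b * (norm f)\<^sup>2"
  unfolding ell2_def ell2_norm_squared mem_Collect_eq
  by (rule nonneg_infsum_le; use besselD[OF assms] in force)+

lemma frame_bounds:
  assumes "is_frame I v"
  obtains a b where "0 < a" "bessel I v b"
    "\<And>f. a * (norm f)\<^sup>2 \<le> (ell2_norm I (\<lambda>i. cinner f (v i)))\<^sup>2"
proof -
  obtain a b where ab: "0 < a" "0 < b"
    and s: "\<And>f. (\<lambda>i. (cmod (cinner f (v i)))\<^sup>2) summable_on I"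
    and l: "\<And>f. a * (norm f)\<^sup>2 \<le> (\<Sum>\<^sub>\<infinity>i\<in>I. (cmod (cinner f (v i)))\<^sup>2)"
    and u: "\<And>f. (\<Sum>\<^sub>\<infinity>i\<in>I. (cmod (cinner f (v i)))\<^sup>2) \<le> b * (norm f)\<^sup>2"
    using assms by (auto simp: is_frame_def)
  have "bessel I v b"
    unfolding bessel_def
  proof (intro conjI allI impI ab)
    fix f F assume "finite F \<and> F \<subseteq> I"
    then have "(\<Sum>i\<in>F. (cmod (cinner f (v i)))\<^sup>2) \<le> (\<Sum>\<^sub>\<infinity>i\<in>I. (cmod (cinner f (v i)))\<^sup>2)"
      by (intro finite_sum_le_infsum s) auto
    then show "(\<Sum>i\<in>F. (cmod (cinner f (v i)))\<^sup>2) \<le> b * (norm f)\<^sup>2"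
      using u[of f] by linarith
  qed
  then show ?thesis using that[OF ab(1)] l by (simp add: ell2_norm_squared)
qed

lemma frameI:
  assumes "0 < a" "bessel I v b"
    "\<And>f. a * (norm f)\<^sup>2 \<le> (ell2_norm I (\<lambda>i. cinner f (v i)))\<^sup>2"
  shows "is_frame I v"
  unfolding is_frame_def
  using assms bessel_pos[OF assms(2)] bessel_coeffs_ell2[OF assms(2)]
  by (intro exI[of _ a] exI[of _ b] conjI allI) (auto simp: ell2_norm_squared ell2_def)

text \<open>The synthesis map is the adjoint of the analysis map \<open>f \<mapsto> (\<langle>f, v\<^sub>i\<rangle>)\<^sub>i\<close>, so it obeys the same
  bound.\<close>

lemma bessel_synthesis_finite:
  assumes "bessel I v b" "finite F" "F \<subseteq> I"
  shows "(norm (\<Sum>i\<in>F. scaleC (x i) (v i)))\<^sup>2 \<le> b * (\<Sum>i\<in>F. (cmod (x i))\<^sup>2)"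
proof -
  define g where "g = (\<Sum>i\<in>F. scaleC (x i) (v i))"
  define X where "X = L2_set (\<lambda>i. cmod (x i)) F"
  have "complex_of_real ((norm g)\<^sup>2) = (\<Sum>i\<in>F. x i * cinner (v i) g)"
    unfolding cinner_self[symmetric]
    by (subst g_def) (simp add: cinner_sum_left cinner_scaleC_left)
  then have "(norm g)\<^sup>2 = cmod (\<Sum>i\<in>F. x i * cinner (v i) g)"
    by (metis abs_of_nonneg norm_of_real zero_le_power2)
  also have "\<dots> \<le> X * L2_set (\<lambda>i. cmod (cinner (v i) g)) F"
    unfolding X_def by (rule cmod_sum_mult_le)
  also have "(\<lambda>i. cmod (cinner (v i) g)) = (\<lambda>i. cmod (cinner g (v i)))"
    by (metis cinner_commute complex_mod_cnj)
  also have "X * L2_set (\<lambda>i. cmod (cinner g (v i))) F \<le> X * (sqrt b * norm g)"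
    by (intro mult_left_mono bessel_L2_set_le[OF assms]) (simp add: X_def)
  finally have "norm g * norm g \<le> (X * sqrt b) * norm g"
    by (simp add: power2_eq_square mult.assoc)
  then have "norm g \<le> X * sqrt b"
    using L2_set_nonneg[of "\<lambda>i. cmod (x i)" F] bessel_pos[OF assms(1)]
    by (cases "g = 0") (auto simp: X_def)
  then have "(norm g)\<^sup>2 \<le> (X * sqrt b)\<^sup>2" by (rule power_mono) simp
  then show ?thesis
    using bessel_pos[OF assms(1)]
    by (simp add: g_def X_def power_mult_distrib L2_set_squared mult.commute)
qed

text \<open>By the finite estimate the norm of a partial sum over a finite set \<open>G\<close> is controlled by the
  \<open>\<ell>\<^sup>2\<close> norm of \<open>x\<close> on \<open>G\<close>; hence the net of partial sums is Cauchy, although the series need not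
  converge absolutely.\<close>

lemma bessel_synthesis:
  assumes b: "bessel I v b" and x: "x \<in> ell2 I"
  shows "(\<lambda>i. scaleC (x i) (v i)) summable_on I"
    and "(norm (\<Sum>\<^sub>\<infinity>i\<in>I. scaleC (x i) (v i)))\<^sup>2 \<le> b * (ell2_norm I x)\<^sup>2"
proof -
  let ?g = "\<lambda>i. scaleC (x i) (v i)"
  note b0 = bessel_pos[OF b]
  have cauchy: "\<exists>P. eventually P (finite_subsets_at_top I) \<and>
      (\<forall>F F'. P F \<and> P F' \<longrightarrow> dist (sum ?g F) (sum ?g F') < e)" if "0 < e" for e
  proof -
    have "0 < e\<^sup>2 / (4 * b)" using that b0 by simp
    then obtain F0 where F0: "finite F0" "F0 \<subseteq> I"
      and tail: "\<And>G. finite G \<Longrightarrow> G \<subseteq> I - F0 \<Longrightarrow> (\<Sum>i\<in>G. (cmod (x i))\<^sup>2) < e\<^sup>2 / (4 * b)"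
      using ell2_tail[OF x] by metis
    define P where "P F \<longleftrightarrow> finite F \<and> F0 \<subseteq> F \<and> F \<subseteq> I" for F
    have near: "dist (sum ?g F) (sum ?g F0) < e / 2" if "P F" for F
    proof -
      have F: "finite (F - F0)" "F - F0 \<subseteq> I - F0" "F - F0 \<subseteq> I"
        using that by (auto simp: P_def)
      have "(norm (sum ?g (F - F0)))\<^sup>2 \<le> b * (\<Sum>i\<in>F - F0. (cmod (x i))\<^sup>2)"
        by (rule bessel_synthesis_finite[OF b F(1,3)])
      also have "\<dots> < b * (e\<^sup>2 / (4 * b))"
        using tail[OF F(1,2)] b0 by (rule mult_strict_left_mono)
      also have "\<dots> = (e / 2)\<^sup>2" using b0 by (simp add: power2_eq_square)
      finally have "norm (sum ?g (F - F0)) < e / 2"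
        by (rule power_less_imp_less_base) (use \<open>0 < e\<close> in simp)
      then show ?thesis
        using that by (simp add: P_def dist_norm sum_diff)
    qed
    have "dist (sum ?g F) (sum ?g F') < e" if "P F \<and> P F'" for F F'
      using near[of F] near[of F'] that dist_triangle2[of "sum ?g F" "sum ?g F'" "sum ?g F0"]
      by linarith
    moreover have "eventually P (finite_subsets_at_top I)"
      unfolding eventually_finite_subsets_at_top P_def using F0 by blast
    ultimately show ?thesis by blast
  qed
  then have "cauchy_filter (filtermap (sum ?g) (finite_subsets_at_top I))"
    by (simp add: cauchy_filter_metric_filtermap)
  moreover have "complete (UNIV :: 'b set)"
    by (meson Cauchy_convergent UNIV_I complete_def convergent_def)
  ultimately obtain L where L: "(?g has_sum L) I"
    unfolding has_sum_def using complete_uniform[where S = UNIV] by (force simp add: filterlim_def)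
  then show s: "?g summable_on I" by (auto simp: summable_on_def)
  have "((\<lambda>F. (norm (sum ?g F))\<^sup>2) \<longlongrightarrow> (norm L)\<^sup>2) (finite_subsets_at_top I)"
    using L unfolding has_sum_def by (intro tendsto_intros)
  moreover have "(norm (sum ?g F))\<^sup>2 \<le> b * (ell2_norm I x)\<^sup>2" if "finite F" "F \<subseteq> I" for F
    using bessel_synthesis_finite[OF b that, of x] ell2_finite_sum_le[OF x that] b0
    by (meson less_imp_le mult_left_mono order_trans)
  ultimately have "(norm L)\<^sup>2 \<le> b * (ell2_norm I x)\<^sup>2"
    by (intro tendsto_upperbound[where F = "finite_subsets_at_top I"])
      (auto intro: eventually_finite_subsets_at_top_weakI)
  then show "(norm (\<Sum>\<^sub>\<infinity>i\<in>I. scaleC (x i) (v i)))\<^sup>2 \<le> b * (ell2_norm I x)\<^sup>2"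
    using L by (simp add: infsumI)
qed

definition frame_operator :: "'i set \<Rightarrow> ('i \<Rightarrow> 'a::complex_hilbert_space) \<Rightarrow> 'a \<Rightarrow> 'a" where
  "frame_operator I v f = (\<Sum>\<^sub>\<infinity>i\<in>I. scaleC (cinner f (v i)) (v i))"

lemma frame_operator_has_sum:
  assumes "bessel I v b"
  shows "((\<lambda>i. scaleC (cinner f (v i)) (v i)) has_sum frame_operator I v f) I"
  unfolding frame_operator_def
  by (rule has_sum_infsum, rule bessel_synthesis(1)[OF assms bessel_coeffs_ell2(1)[OF assms]])

lemma cinner_frame_operator:
  assumes "bessel I v b"
  shows "((\<lambda>i. cinner f (v i) * cinner (v i) g) has_sum cinner (frame_operator I v f) g) I"
  using has_sum_bounded_linear[OF bounded_linear_cinner_left frame_operator_has_sum[OF assms]]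
  by (simp add: cinner_scaleC_left)

lemma frame_operator_symmetric:
  assumes "bessel I v b"
  shows "cinner (frame_operator I v f) g = cinner f (frame_operator I v g)"
proof -
  have "((\<lambda>i. cinner f (v i) * cinner (v i) g) has_sum cinner f (frame_operator I v g)) I"
    using has_sum_bounded_linear[OF bounded_linear_cinner_right[of f]
        frame_operator_has_sum[OF assms, of g]]
    by (simp add: cinner_scaleC_right cinner_commute[symmetric] mult.commute)
  then show ?thesis using cinner_frame_operator[OF assms] has_sum_unique by blast
qed

lemma frame_operator_diff:
  assumes "bessel I v b"
  shows "frame_operator I v (f - g) = frame_operator I v f - frame_operator I v g"
proof -
  have "((\<lambda>i. scaleC (cinner f (v i)) (v i) + (- 1) *\<^sub>R scaleC (cinner g (v i)) (v i))
      has_sum (frame_operator I v f + (- 1) *\<^sub>R frame_operator I v g)) I"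
    by (intro has_sum_add frame_operator_has_sum[OF assms]
        has_sum_bounded_linear[OF bounded_linear_scaleR_right])
  moreover have "scaleC (cinner f (v i)) (v i) + (- 1) *\<^sub>R scaleC (cinner g (v i)) (v i)
      = scaleC (cinner (f - g) (v i)) (v i)" for i
    by (simp add: cinner_diff_left scaleC_diff_left)
  ultimately show ?thesis
    using frame_operator_has_sum[OF assms, of "f - g"] has_sum_unique by force
qed

text \<open>The frame operator \<open>S\<close> is bounded by \<open>b\<close> and satisfies \<open>\<langle>S f, f\<rangle> \<ge> a \<parallel>f\<parallel>\<^sup>2\<close>, hence
  \<open>\<parallel>f - t S f\<parallel>\<^sup>2 \<le> (1 - 2 t a + t\<^sup>2 b\<^sup>2) \<parallel>f\<parallel>\<^sup>2\<close>. For \<open>t = a / b\<^sup>2\<close> the factor is \<open>1 - a\<^sup>2 / b\<^sup>2 < 1\<close>, so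
  solving \<open>S f = g\<close> is a fixed point problem for the contraction \<open>f \<mapsto> f - t S f + t g\<close>.\<close>

lemma frame_operator_surj:
  assumes "is_frame I v"
  shows "\<exists>f. frame_operator I v f = g"
proof -
  obtain a b where a: "0 < a" and b: "bessel I v b"
    and lower: "\<And>f. a * (norm f)\<^sup>2 \<le> (ell2_norm I (\<lambda>i. cinner f (v i)))\<^sup>2"
    using frame_bounds[OF assms] by metis
  define S where "S = frame_operator I v"
  note b0 = bessel_pos[OF b]
  have pos: "a * (norm f)\<^sup>2 \<le> Re (cinner (S f) f)" for f
  proof -
    have "((\<lambda>i. Re (cinner f (v i) * cinner (v i) f)) has_sum Re (cinner (S f) f)) I"
      unfolding S_def by (intro has_sum_Re cinner_frame_operator[OF b])
    moreover have "Re (cinner f (v i) * cinner (v i) f) = (cmod (cinner f (v i)))\<^sup>2" for i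
      by (metis Re_complex_of_real cinner_commute complex_norm_square)
    ultimately have "Re (cinner (S f) f) = (ell2_norm I (\<lambda>i. cinner f (v i)))\<^sup>2"
      by (simp add: ell2_norm_squared infsumI)
    then show ?thesis using lower by simp
  qed
  have bd: "(norm (S f))\<^sup>2 \<le> b\<^sup>2 * (norm f)\<^sup>2" for f
  proof -
    have "(norm (S f))\<^sup>2 \<le> b * (ell2_norm I (\<lambda>i. cinner f (v i)))\<^sup>2"
      unfolding S_def frame_operator_def
      by (rule bessel_synthesis(2)[OF b bessel_coeffs_ell2(1)[OF b]])
    also have "\<dots> \<le> b * (b * (norm f)\<^sup>2)"
      by (intro mult_left_mono bessel_coeffs_ell2(2)[OF b] less_imp_le[OF b0])
    finally show ?thesis by (simp add: power2_eq_square mult.assoc)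
  qed
  define t where "t = a / b\<^sup>2"
  define r where "r = 1 - a\<^sup>2 / b\<^sup>2"
  have t: "0 < t" using a b0 by (simp add: t_def)
  have tr: "1 - 2 * t * a + t\<^sup>2 * b\<^sup>2 = r"
    using b0 by (simp add: t_def r_def power2_eq_square field_simps)
  have contr: "(norm (f - t *\<^sub>R S f))\<^sup>2 \<le> r * (norm f)\<^sup>2" for f
  proof -
    have "(norm (f - t *\<^sub>R S f))\<^sup>2 = (norm f)\<^sup>2 + 2 * Re (cinner f ((- t) *\<^sub>R S f)) + (norm ((- t) *\<^sub>R S f))\<^sup>2"
      using norm_add_squared[of f "(- t) *\<^sub>R S f"] by simp
    also have "\<dots> = (norm f)\<^sup>2 - 2 * t * Re (cinner (S f) f) + t\<^sup>2 * (norm (S f))\<^sup>2"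
      using frame_operator_symmetric[OF b, of f f]
      unfolding cinner_scaleR_right S_def by (simp add: power_mult_distrib)
    also have "\<dots> \<le> (norm f)\<^sup>2 - 2 * t * (a * (norm f)\<^sup>2) + t\<^sup>2 * (b\<^sup>2 * (norm f)\<^sup>2)"
      using t by (intro add_mono diff_mono mult_left_mono pos bd) auto
    also have "\<dots> = (1 - 2 * t * a + t\<^sup>2 * b\<^sup>2) * (norm f)\<^sup>2" by (simp add: algebra_simps)
    finally show ?thesis by (simp only: tr)
  qed
  show ?thesis
  proof (cases "\<forall>f::'b. f = 0")
    case True
    then show ?thesis by metis
  next
    case False
    then obtain f0 :: 'b where "f0 \<noteq> 0" by blast
    have "0 \<le> r * (norm f0)\<^sup>2"
      by (rule order_trans[OF zero_le_power2 contr])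
    then have r0: "0 \<le> r" using \<open>f0 \<noteq> 0\<close> by (simp add: zero_le_mult_iff)
    have r1: "sqrt r < 1" using a b0 by (simp add: r_def)
    have "\<exists>!f. f - t *\<^sub>R S f + t *\<^sub>R g = f"
    proof (rule banach_fix_type[of "sqrt r"])
      show "0 \<le> sqrt r" "sqrt r < 1" using r0 r1 by auto
      show "\<forall>f h. dist (f - t *\<^sub>R S f + t *\<^sub>R g) (h - t *\<^sub>R S h + t *\<^sub>R g) \<le> sqrt r * dist f h"
      proof (intro allI)
        fix f h
        have "f - t *\<^sub>R S f + t *\<^sub>R g - (h - t *\<^sub>R S h + t *\<^sub>R g) = (f - h) - t *\<^sub>R S (f - h)"
          unfolding S_def frame_operator_diff[OF b] by (simp add: algebra_simps)
        then have "(dist (f - t *\<^sub>R S f + t *\<^sub>R g) (h - t *\<^sub>R S h + t *\<^sub>R g))\<^sup>2 \<le> (sqrt r * dist f h)\<^sup>2"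
          using contr[of "f - h"] r0 by (simp only: dist_norm power_mult_distrib real_sqrt_pow2)
        then show "dist (f - t *\<^sub>R S f + t *\<^sub>R g) (h - t *\<^sub>R S h + t *\<^sub>R g) \<le> sqrt r * dist f h"
          by (rule power2_le_imp_le) (simp add: r0)
      qed
    qed
    then obtain f where "f - t *\<^sub>R S f + t *\<^sub>R g = f" by blast
    then have "t *\<^sub>R S f = t *\<^sub>R g" by (simp only: diff_add_eq diff_eq_eq add_left_cancel)
    then have "S f = g" using t by (metis scaleR_cancel_left less_irrefl)
    then show ?thesis by (auto simp: S_def)
  qed
qed

section \<open>Weak limits along a frame\<close>

text \<open>Up to a uniformly small error the tail of \<open>y\<close> can be dropped, and on the remaining finite set
  pointwise convergence is enough.\<close>

lemma ell2_pairing_tendsto_zero: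
  assumes bound: "\<And>n F. finite F \<Longrightarrow> F \<subseteq> I \<Longrightarrow> L2_set (\<lambda>i. cmod (z n i)) F \<le> M"
    and pointwise: "\<And>i. i \<in> I \<Longrightarrow> (\<lambda>n. z n i) \<longlonglongrightarrow> 0"
    and y: "y \<in> ell2 I"
    and sum: "\<And>n. ((\<lambda>i. z n i * y i) has_sum s n) I"
  shows "s \<longlonglongrightarrow> 0"
proof (rule LIMSEQ_I)
  fix e :: real assume "0 < e"
  have M: "0 \<le> M" using bound[of "{}" 0] by simp
  define d where "d = e / (2 * (M + 1))"
  have d: "0 < d" "M * d \<le> e / 2"
    using \<open>0 < e\<close> M by (auto simp: d_def field_simps)
  obtain F where F: "finite F" "F \<subseteq> I"
    and tail: "\<And>G. finite G \<Longrightarrow> G \<subseteq> I - F \<Longrightarrow> (\<Sum>i\<in>G. (cmod (y i))\<^sup>2) < d\<^sup>2"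
    using ell2_tail[OF y, of "d\<^sup>2"] d(1) by auto
  have near: "cmod (s n) \<le> cmod (\<Sum>i\<in>F. z n i * y i) + e / 2" for n
  proof (rule tendsto_upperbound[where F = "finite_subsets_at_top I"])
    show "((\<lambda>G. cmod (\<Sum>i\<in>G. z n i * y i)) \<longlongrightarrow> cmod (s n)) (finite_subsets_at_top I)"
      using sum[of n] unfolding has_sum_def by (intro tendsto_norm)
    have "cmod (\<Sum>i\<in>G. z n i * y i) \<le> cmod (\<Sum>i\<in>F. z n i * y i) + e / 2"
      if G: "finite G" "F \<subseteq> G" "G \<subseteq> I" for G
    proof -
      have GF: "finite (G - F)" "G - F \<subseteq> I - F" "G - F \<subseteq> I" using G by auto
      have "L2_set (\<lambda>i. cmod (y i)) (G - F) \<le> d"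
        using tail[OF GF(1,2)] d(1) by (simp add: L2_set_le_iff)
      then have "L2_set (\<lambda>i. cmod (z n i)) (G - F) * L2_set (\<lambda>i. cmod (y i)) (G - F) \<le> M * d"
        using bound[OF GF(1,3)] M by (intro mult_mono) auto
      then have "cmod (\<Sum>i\<in>G - F. z n i * y i) \<le> e / 2"
        using cmod_sum_mult_le[of "z n" y "G - F"] d(2) by linarith
      moreover have "(\<Sum>i\<in>G. z n i * y i) = (\<Sum>i\<in>F. z n i * y i) + (\<Sum>i\<in>G - F. z n i * y i)"
        using G sum.subset_diff[of F G "\<lambda>i. z n i * y i"] by (simp add: add.commute)
      ultimately show ?thesis
        using norm_triangle_ineq[of "\<Sum>i\<in>F. z n i * y i" "\<Sum>i\<in>G - F. z n i * y i"] by simp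
    qed
    then show "\<forall>\<^sub>F G in finite_subsets_at_top I.
        cmod (\<Sum>i\<in>G. z n i * y i) \<le> cmod (\<Sum>i\<in>F. z n i * y i) + e / 2"
      unfolding eventually_finite_subsets_at_top using F by blast
  qed simp
  have "(\<lambda>n. \<Sum>i\<in>F. z n i * y i) \<longlonglongrightarrow> (\<Sum>i\<in>F. 0 * y i)"
    using pointwise F(2) by (intro tendsto_sum tendsto_mult_right) auto
  then obtain N where "\<And>n. n \<ge> N \<Longrightarrow> cmod (\<Sum>i\<in>F. z n i * y i) < e / 2"
    using LIMSEQ_D[of _ 0 "e / 2"] \<open>0 < e\<close> by fastforce
  then have "\<forall>n\<ge>N. norm (s n - 0) < e"
    using near by (smt (verit) diff_zero field_sum_of_halves)
  then show "\<exists>N. \<forall>n\<ge>N. norm (s n - 0) < e" by blast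
qed

text \<open>This takes the place of weak sequential compactness. The limiting coefficients \<open>x\<close> are square summable, the
  limit is the solution \<open>h\<close> of \<open>S h = \<Sum> x\<^sub>i v\<^sub>i\<close>, and every test vector is of the form \<open>S u\<close>, against
  which both sides are pairings of coefficient sequences.\<close>

lemma frame_weak_limit:
  assumes frame: "is_frame I v"
    and bounded: "\<And>n. norm (f n) \<le> R"
    and conv: "\<And>i. i \<in> I \<Longrightarrow> (\<lambda>n. cinner (f n) (v i)) \<longlonglongrightarrow> x i"
  obtains h where "\<And>u. (\<lambda>n. cinner (f n) u) \<longlonglongrightarrow> cinner h u"
proof -
  obtain b where b: "bessel I v b" using frame_bounds[OF frame] by metis
  define M where "M = sqrt b * R"
  have fM: "L2_set (\<lambda>i. cmod (cinner (f n) (v i))) F \<le> M" if "finite F" "F \<subseteq> I" for n F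
    using bessel_L2_set_le[OF b that, of "f n"] bounded[of n] bessel_pos[OF b]
    by (metis M_def less_imp_le mult_left_mono order_trans real_sqrt_ge_zero)
  have xM: "L2_set (\<lambda>i. cmod (x i)) F \<le> M" if F: "finite F" "F \<subseteq> I" for F
  proof (rule tendsto_upperbound[where F = sequentially])
    show "(\<lambda>n. L2_set (\<lambda>i. cmod (cinner (f n) (v i))) F) \<longlonglongrightarrow> L2_set (\<lambda>i. cmod (x i)) F"
      unfolding L2_set_def using conv F(2) by (intro tendsto_intros) auto
  qed (use fM[OF F] in auto)
  have M: "0 \<le> M" using xM[of "{}"] by simp
  have x: "x \<in> ell2 I"
    unfolding ell2_def mem_Collect_eq
    by (rule nonneg_infsum_le(1)[of _ _ "M\<^sup>2"]) (use xM M in \<open>auto simp: L2_set_le_iff\<close>)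
  define g where "g = (\<Sum>\<^sub>\<infinity>i\<in>I. scaleC (x i) (v i))"
  have g: "((\<lambda>i. scaleC (x i) (v i)) has_sum g) I"
    unfolding g_def by (intro has_sum_infsum bessel_synthesis(1)[OF b x])
  obtain h where h: "frame_operator I v h = g"
    using frame_operator_surj[OF frame] by blast
  have "(\<lambda>n. cinner (f n) u) \<longlonglongrightarrow> cinner h u" for u
  proof -
    obtain u' where u': "frame_operator I v u' = u"
      using frame_operator_surj[OF frame] by blast
    have "(\<lambda>n. cinner (f n) u - cinner h u) \<longlonglongrightarrow> 0"
    proof (rule ell2_pairing_tendsto_zero)
      show "L2_set (\<lambda>i. cmod (cinner (f n) (v i) - x i)) F \<le> M + M"
        if "finite F" "F \<subseteq> I" for n F
        using L2_set_cmod_add_le[of "\<lambda>i. cinner (f n) (v i)" "\<lambda>i. - x i" F] fM[OF that, of n] xM[OF that]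
        by simp
      show "(\<lambda>n. cinner (f n) (v i) - x i) \<longlonglongrightarrow> 0" if "i \<in> I" for i
        using conv[OF that] by (simp add: LIM_zero)
      have "cmod (cinner (v i) u') = cmod (cinner u' (v i))" for i
        by (metis cinner_commute complex_mod_cnj)
      then show "(\<lambda>i. cinner (v i) u') \<in> ell2 I"
        using bessel_coeffs_ell2(1)[OF b, of u'] by (simp add: ell2_def)
      have "((\<lambda>i. cinner (f n) (v i) * cinner (v i) u' + - (x i * cinner (v i) u'))
          has_sum cinner (frame_operator I v (f n)) u' + - cinner g u') I" for n
        using has_sum_bounded_linear[OF bounded_linear_cinner_left g, of u']
        by (intro has_sum_add cinner_frame_operator[OF b])
          (simp add: cinner_scaleC_left has_sum_uminus)
      moreover have "cinner (frame_operator I v (f n)) u' + - cinner g u' = cinner (f n) u - cinner h u" for n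
        by (simp add: h[symmetric] u'[symmetric] frame_operator_symmetric[OF b])
      ultimately show "((\<lambda>i. (cinner (f n) (v i) - x i) * cinner (v i) u')
          has_sum (cinner (f n) u - cinner h u)) I" for n
        by (simp add: left_diff_distrib)
    qed
    then show ?thesis by (simp add: LIM_zero_iff)
  qed
  then show ?thesis by (rule that)
qed

section \<open>Weavings of two frames have a common lower frame bound\<close>

definition weaving :: "'i set \<Rightarrow> ('i \<Rightarrow> 'a) \<Rightarrow> ('i \<Rightarrow> 'a) \<Rightarrow> 'i \<Rightarrow> 'a" where
  "weaving J v w = (\<lambda>i. if i \<in> J then v i else w i)"

lemma bessel_weaving:
  assumes "bessel I v b" "bessel I w c"
  shows "bessel I (weaving J v w) (b + c)"
  unfolding bessel_def
proof (intro conjI allI impI)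
  show "0 < b + c" using assms by (simp add: bessel_def)
  fix f F assume F: "finite F \<and> F \<subseteq> I"
  have "(\<Sum>i\<in>F. (cmod (cinner f (weaving J v w i)))\<^sup>2)
      \<le> (\<Sum>i\<in>F. (cmod (cinner f (v i)))\<^sup>2 + (cmod (cinner f (w i)))\<^sup>2)"
    by (rule sum_mono) (simp add: weaving_def)
  also have "\<dots> \<le> b * (norm f)\<^sup>2 + c * (norm f)\<^sup>2"
    using besselD[OF assms(1), of F f] besselD[OF assms(2), of F f] F by (simp add: sum.distrib)
  finally show "(\<Sum>i\<in>F. (cmod (cinner f (weaving J v w i)))\<^sup>2) \<le> (b + c) * (norm f)\<^sup>2"
    by (simp add: distrib_right)
qed

text \<open>If no common lower bound exists, there are index sets \<open>J\<^sub>n\<close> and unit vectors \<open>f\<^sub>n\<close> whose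
  coefficients along the weaving over \<open>J\<^sub>n\<close> have \<open>\<ell>\<^sup>2\<close> norms tending to zero. Passing to a subsequence, \<open>J\<^sub>n\<close>
  converges pointwise to some \<open>J\<close> and \<open>f\<^sub>n\<close> weakly to some \<open>h\<close>. All coefficients of \<open>h\<close> along the
  weaving over \<open>J\<close> vanish, and that weaving is a frame; so \<open>h = 0\<close>.\<close>

lemma weakly_null_degenerate_weavings:
  assumes "countable I" and v: "is_frame I v" and w: "is_frame I w"
    and weave: "\<And>J. J \<subseteq> I \<Longrightarrow> is_frame I (weaving J v w)"
    and fail: "\<And>c. 0 < c \<Longrightarrow> \<exists>J\<subseteq>I. \<exists>f. (ell2_norm I (\<lambda>i. cinner f (weaving J v w i)))\<^sup>2 < c * (norm f)\<^sup>2"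
  obtains J f where "\<And>n. norm (f n) = 1"
    "\<And>u. (\<lambda>n. cinner (f n) u) \<longlonglongrightarrow> 0"
    "(\<lambda>n. (ell2_norm I (\<lambda>i. cinner (f n) (weaving (J n) v w i)))\<^sup>2) \<longlonglongrightarrow> 0"
proof -
  obtain b where b: "bessel I v b" using frame_bounds[OF v] by metis
  obtain b' where b': "bessel I w b'" using frame_bounds[OF w] by metis
  have "\<exists>J f. norm f = 1 \<and> (ell2_norm I (\<lambda>i. cinner f (weaving J v w i)))\<^sup>2 < inverse (Suc n)" for n
  proof -
    obtain J f where f: "(ell2_norm I (\<lambda>i. cinner f (weaving J v w i)))\<^sup>2 < inverse (Suc n) * (norm f)\<^sup>2"
      using fail[of "inverse (Suc n)"] by auto
    have "norm f \<noteq> 0"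
      using f by (metis mult_zero_right not_less power_zero_numeral zero_le_power2)
    define r where "r = inverse (norm f)"
    have "(ell2_norm I (\<lambda>i. cinner (r *\<^sub>R f) (weaving J v w i)))\<^sup>2
        = r\<^sup>2 * (ell2_norm I (\<lambda>i. cinner f (weaving J v w i)))\<^sup>2"
      unfolding ell2_norm_squared
      by (simp add: cinner_scaleR_left power_mult_distrib infsum_cmult_right')
    also have "\<dots> < r\<^sup>2 * (inverse (Suc n) * (norm f)\<^sup>2)"
      using f \<open>norm f \<noteq> 0\<close> by (intro mult_strict_left_mono) (auto simp: r_def)
    also have "\<dots> = inverse (Suc n)"
      using \<open>norm f \<noteq> 0\<close> by (simp add: r_def field_simps power2_eq_square)
    finally have "(ell2_norm I (\<lambda>i. cinner (r *\<^sub>R f) (weaving J v w i)))\<^sup>2 < inverse (Suc n)" .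
    moreover have "norm (r *\<^sub>R f) = 1" using \<open>norm f \<noteq> 0\<close> by (simp add: r_def)
    ultimately show ?thesis by blast
  qed
  then obtain J f where unit: "\<And>n. norm (f n) = 1"
    and small: "\<And>n. (ell2_norm I (\<lambda>i. cinner (f n) (weaving (J n) v w i)))\<^sup>2 < inverse (Suc n)"
    by metis
  \<comment> \<open>The coefficient of \<open>f\<^sub>n\<close> at \<open>i\<close> is paired with the indicator of \<open>J\<^sub>n\<close> at \<open>i\<close>, so that one
      subsequence serves both.\<close>
  define q where "q n i = (cinner (f n) (v i), if i \<in> J n then 1 else 0 :: real)" for n i
  have "norm (q n i) \<le> sqrt b + 1" if "i \<in> I" for n i
  proof -
    have "cmod (cinner (f n) (v i)) \<le> sqrt b"
      using bessel_L2_set_le[OF b, of "{i}" "f n"] that by (simp add: unit)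
    then show ?thesis
      using norm_Pair_le[of "cinner (f n) (v i)" "if i \<in> J n then 1 else 0 :: real"]
      by (simp add: q_def split: if_splits)
  qed
  then obtain k where k: "strict_mono (k :: nat \<Rightarrow> nat)" "\<And>i. i \<in> I \<Longrightarrow> \<exists>l. (\<lambda>n. q (k n) i) \<longlonglongrightarrow> l"
    using function_convergent_subsequence[OF assms(1), of q] by metis
  then obtain l where l: "\<And>i. i \<in> I \<Longrightarrow> (\<lambda>n. q (k n) i) \<longlonglongrightarrow> l i" by metis
  have small': "(\<lambda>n. (ell2_norm I (\<lambda>i. cinner (f (k n)) (weaving (J (k n)) v w i)))\<^sup>2) \<longlonglongrightarrow> 0"
  proof -
    have "(\<lambda>n. (ell2_norm I (\<lambda>i. cinner (f n) (weaving (J n) v w i)))\<^sup>2) \<longlonglongrightarrow> 0"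
      by (rule tendsto_sandwich[OF _ _ tendsto_const LIMSEQ_inverse_real_of_nat])
        (use small less_imp_le in \<open>auto intro!: always_eventually\<close>)
    then show ?thesis using LIMSEQ_subseq_LIMSEQ[OF _ k(1)] by (force simp: o_def)
  qed
  obtain h where h: "\<And>u. (\<lambda>n. cinner (f (k n)) u) \<longlonglongrightarrow> cinner h u"
  proof (rule frame_weak_limit[OF v, of "\<lambda>n. f (k n)" 1 "\<lambda>i. fst (l i)"])
    show "(\<lambda>n. cinner (f (k n)) (v i)) \<longlonglongrightarrow> fst (l i)" if "i \<in> I" for i
      using tendsto_fst[OF l[OF that]] by (simp add: q_def)
  qed (auto simp: unit)
  \<comment> \<open>The indicators take the values 0 and 1 and converge, so any threshold strictly between
      recovers the limit set.\<close>
  define K where "K = {i \<in> I. snd (l i) > 1 / 2}"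
  have "cinner h (weaving K v w i) = 0" if i: "i \<in> I" for i
  proof -
    have lim: "(\<lambda>n. if i \<in> J (k n) then 1 else 0 :: real) \<longlonglongrightarrow> snd (l i)"
      using tendsto_snd[OF l[OF i]] by (simp add: q_def)
    have ev: "\<forall>\<^sub>F n in sequentially. weaving (J (k n)) v w i = weaving K v w i"
    proof (cases "i \<in> K")
      case True
      then have "\<forall>\<^sub>F n in sequentially. (if i \<in> J (k n) then 1 else 0 :: real) > 1 / 2"
        by (intro order_tendstoD[OF lim]) (simp add: K_def)
      then show ?thesis by eventually_elim (use True in \<open>auto simp: weaving_def split: if_splits\<close>)
    next
      case False
      then have "\<forall>\<^sub>F n in sequentially. (if i \<in> J (k n) then 1 else 0 :: real) < 1"
        using i by (intro order_tendstoD[OF lim]) (simp add: K_def)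
      then show ?thesis by eventually_elim (use False in \<open>auto simp: weaving_def split: if_splits\<close>)
    qed
    have "(cmod (cinner (f (k n)) (weaving (J (k n)) v w i)))\<^sup>2
        \<le> (ell2_norm I (\<lambda>i. cinner (f (k n)) (weaving (J (k n)) v w i)))\<^sup>2" for n
      using ell2_finite_sum_le[OF bessel_coeffs_ell2(1)[OF bessel_weaving[OF b b']], of "{i}"] i by simp
    then have "(\<lambda>n. (cmod (cinner (f (k n)) (weaving (J (k n)) v w i)))\<^sup>2) \<longlonglongrightarrow> 0"
      by (intro tendsto_sandwich[OF _ _ tendsto_const small']) auto
    then have "(\<lambda>n. (cmod (cinner (f (k n)) (weaving K v w i)))\<^sup>2) \<longlonglongrightarrow> 0"
      by (rule Lim_transform_eventually) (use ev in eventually_elim, simp)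
    moreover have "(\<lambda>n. (cmod (cinner (f (k n)) (weaving K v w i)))\<^sup>2) \<longlonglongrightarrow> (cmod (cinner h (weaving K v w i)))\<^sup>2"
      by (intro tendsto_intros h)
    ultimately show ?thesis using LIMSEQ_unique by fastforce
  qed
  then have "(ell2_norm I (\<lambda>i. cinner h (weaving K v w i)))\<^sup>2 = 0"
    unfolding ell2_norm_squared by (intro infsum_0) simp
  moreover obtain a where "0 < a" "a * (norm h)\<^sup>2 \<le> (ell2_norm I (\<lambda>i. cinner h (weaving K v w i)))\<^sup>2"
    by (rule frame_bounds[OF weave[of K]]) (auto simp: K_def)
  ultimately have "h = 0" by (simp add: mult_le_0_iff)
  then show ?thesis
    using that[of "\<lambda>n. f (k n)" "\<lambda>n. J (k n)"] unit h small' by (simp add: cinner_zero_left)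
qed

text \<open>Starting from the previous lemma, a gliding hump argument assembles a single bad index set. A weakly null sequence has negligible coefficients on any given finite set
  \<open>F\<^sub>k\<close>, and each member has negligible coefficients off a larger finite set \<open>F\<^sub>k\<^sub>+\<^sub>1\<close>; on the layer
  \<open>F\<^sub>k\<^sub>+\<^sub>1 - F\<^sub>k\<close> the set \<open>M\<close> copies the index set of the \<open>k\<close>-th chosen member. The layers are disjoint,
  and the coefficients of every chosen member along the weaving over \<open>M\<close> are small, so this
  weaving has no lower frame bound.\<close>

theorem weaving_uniform_lower_bound:
  assumes "countable I" and v: "is_frame I v" and w: "is_frame I w"
    and weave: "\<And>J. J \<subseteq> I \<Longrightarrow> is_frame I (weaving J v w)"
  shows "\<exists>c>0. \<forall>J\<subseteq>I. \<forall>f. c * (norm f)\<^sup>2 \<le> (ell2_norm I (\<lambda>i. cinner f (weaving J v w i)))\<^sup>2"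
proof (rule ccontr)
  assume "\<not> ?thesis"
  then have fail: "\<And>c. 0 < c \<Longrightarrow> \<exists>J\<subseteq>I. \<exists>f. (ell2_norm I (\<lambda>i. cinner f (weaving J v w i)))\<^sup>2 < c * (norm f)\<^sup>2"
    by (meson not_less)
  obtain J f where unit: "\<And>n. norm (f n) = 1"
    and null: "\<And>u. (\<lambda>n. cinner (f n) u) \<longlonglongrightarrow> 0"
    and small: "(\<lambda>n. (ell2_norm I (\<lambda>i. cinner (f n) (weaving (J n) v w i)))\<^sup>2) \<longlonglongrightarrow> 0"
    by (rule weakly_null_degenerate_weavings[OF assms fail]) (assumption | rule that)+
  obtain b where b: "bessel I v b" using frame_bounds[OF v] by metis
  obtain b' where b': "bessel I w b'" using frame_bounds[OF w] by metis
  define q where "q n i = (cmod (cinner (f n) (v i)))\<^sup>2 + (cmod (cinner (f n) (w i)))\<^sup>2" for n i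
  have step: "\<exists>n G. finite G \<and> G \<subseteq> I \<and> F \<subseteq> G \<and> sum (q n) F < e
      \<and> (ell2_norm I (\<lambda>i. cinner (f n) (weaving (J n) v w i)))\<^sup>2 < e
      \<and> (\<forall>H. finite H \<and> H \<subseteq> I - G \<longrightarrow> sum (q n) H < e)" if F: "finite F" "F \<subseteq> I" and e: "0 < e" for F e
  proof -
    have "(\<lambda>n. sum (q n) F) \<longlonglongrightarrow> (\<Sum>i\<in>F. (cmod 0)\<^sup>2 + (cmod 0)\<^sup>2)"
      unfolding q_def by (intro tendsto_intros null)
    then have "\<forall>\<^sub>F n in sequentially. sum (q n) F < e"
      by (rule order_tendstoD) (simp add: e)
    moreover have "\<forall>\<^sub>F n in sequentially. (ell2_norm I (\<lambda>i. cinner (f n) (weaving (J n) v w i)))\<^sup>2 < e"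
      by (rule order_tendstoD(2)[OF small e])
    ultimately obtain n where n: "sum (q n) F < e"
        "(ell2_norm I (\<lambda>i. cinner (f n) (weaving (J n) v w i)))\<^sup>2 < e"
      using eventually_happens[OF eventually_conj] trivial_limit_sequentially by blast
    obtain G1 where G1: "finite G1" "G1 \<subseteq> I"
      "\<And>H. finite H \<Longrightarrow> H \<subseteq> I - G1 \<Longrightarrow> (\<Sum>i\<in>H. (cmod (cinner (f n) (v i)))\<^sup>2) < e / 2"
      using ell2_tail[OF bessel_coeffs_ell2(1)[OF b, of "f n"], of "e / 2"] e by auto
    obtain G2 where G2: "finite G2" "G2 \<subseteq> I"
      "\<And>H. finite H \<Longrightarrow> H \<subseteq> I - G2 \<Longrightarrow> (\<Sum>i\<in>H. (cmod (cinner (f n) (w i)))\<^sup>2) < e / 2"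
      using ell2_tail[OF bessel_coeffs_ell2(1)[OF b', of "f n"], of "e / 2"] e by auto
    have "sum (q n) H < e" if H: "finite H" "H \<subseteq> I - (F \<union> G1 \<union> G2)" for H
    proof -
      have "H \<subseteq> I - G1" "H \<subseteq> I - G2" using H(2) by auto
      then show ?thesis
        using G1(3)[OF H(1)] G2(3)[OF H(1)] by (simp add: q_def sum.distrib)
    qed
    then show ?thesis
      using n F G1(1,2) G2(1,2) by (intro exI[of _ n] exI[of _ "F \<union> G1 \<union> G2"]) auto
  qed
  define P where "P k F \<longleftrightarrow> finite F \<and> F \<subseteq> I" for k :: nat and F
  define Q where "Q k F G \<longleftrightarrow> F \<subseteq> G \<and> (\<exists>n. sum (q n) F < inverse (Suc k)
      \<and> (ell2_norm I (\<lambda>i. cinner (f n) (weaving (J n) v w i)))\<^sup>2 < inverse (Suc k)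
      \<and> (\<forall>H. finite H \<and> H \<subseteq> I - G \<longrightarrow> sum (q n) H < inverse (Suc k)))" for k F G
  have "\<exists>F. P 0 F" by (auto simp: P_def)
  moreover have "\<exists>G. P (Suc k) G \<and> Q k F G" if "P k F" for k F
    using step[of F "inverse (Suc k)"] that unfolding P_def Q_def by (metis inverse_positive_iff_positive of_nat_0_less_iff zero_less_Suc)
  ultimately obtain F where PF: "\<And>k. P k (F k)" and QF: "\<And>k. Q k (F k) (F (Suc k))"
    using dependent_nat_choice[of P Q] by metis
  have F: "\<And>k. finite (F k)" "\<And>k. F k \<subseteq> I" using PF by (auto simp: P_def)
  have "mono F" using QF by (intro incseq_SucI) (simp add: Q_def)
  from QF obtain n where n: "\<And>k. sum (q (n k)) (F k) < inverse (Suc k)"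
      "\<And>k. (ell2_norm I (\<lambda>i. cinner (f (n k)) (weaving (J (n k)) v w i)))\<^sup>2 < inverse (Suc k)"
      "\<And>k H. finite H \<Longrightarrow> H \<subseteq> I - F (Suc k) \<Longrightarrow> sum (q (n k)) H < inverse (Suc k)"
    unfolding Q_def by metis
  define M where "M = {i \<in> I. \<exists>k. i \<in> F (Suc k) - F k \<and> i \<in> J (n k)}"
  have M: "i \<in> M \<longleftrightarrow> i \<in> J (n k)" if i: "i \<in> F (Suc k) - F k" for i k
  proof -
    have "k' = k" if "i \<in> F (Suc k') - F k'" for k'
    proof (rule ccontr)
      assume "k' \<noteq> k"
      then have "Suc k' \<le> k \<or> Suc k \<le> k'" by auto
      then have "F (Suc k') \<subseteq> F k \<or> F (Suc k) \<subseteq> F k'" using \<open>mono F\<close> by (auto dest: monoD)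
      then show False using i that by auto
    qed
    then show ?thesis using i F(2)[of "Suc k"] unfolding M_def by blast
  qed
  have bound: "(ell2_norm I (\<lambda>i. cinner (f (n k)) (weaving M v w i)))\<^sup>2 \<le> 3 * inverse (Suc k)" for k
    unfolding ell2_norm_squared[of I "\<lambda>i. cinner (f (n k)) (weaving M v w i)"]
  proof (rule nonneg_infsum_le(2))
    fix G assume G: "finite G" "G \<subseteq> I"
    let ?t = "\<lambda>L i. (cmod (cinner (f (n k)) (weaving L v w i)))\<^sup>2"
    let ?mid = "G \<inter> F (Suc k) - F k"
    have tq: "sum (?t L) H \<le> sum (q (n k)) H" for L H
      by (rule sum_mono) (simp add: weaving_def q_def)
    have "sum (?t M) G = sum (?t M) (G \<inter> F k \<union> ?mid \<union> (G - F (Suc k)))"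
      using \<open>mono F\<close> by (intro arg_cong[of _ _ "sum _"]) (auto dest: monoD[of F k "Suc k"])
    also have "\<dots> = sum (?t M) (G \<inter> F k) + sum (?t M) ?mid + sum (?t M) (G - F (Suc k))"
      using G monoD[OF \<open>mono F\<close>, of k "Suc k"] by (subst sum.union_disjoint; auto)+
    finally have split: "sum (?t M) G
        = sum (?t M) (G \<inter> F k) + sum (?t M) ?mid + sum (?t M) (G - F (Suc k))" .
    have "sum (?t M) ?mid = sum (?t (J (n k))) ?mid"
      by (rule sum.cong) (use M[of _ k] in \<open>auto simp: weaving_def\<close>)
    also have "\<dots> \<le> inverse (Suc k)"
      using ell2_finite_sum_le[OF bessel_coeffs_ell2(1)[OF bessel_weaving[OF b b']], of ?mid "f (n k)" "J (n k)"]
        G n(2)[of k] by fastforce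
    finally have mid: "sum (?t M) ?mid \<le> inverse (Suc k)" .
    have inner: "sum (?t M) (G \<inter> F k) \<le> inverse (Suc k)"
    proof -
      have "sum (q (n k)) (G \<inter> F k) \<le> sum (q (n k)) (F k)"
        using F by (intro sum_mono2) (auto simp: q_def)
      then show ?thesis using tq[of M "G \<inter> F k"] n(1)[of k] by linarith
    qed
    have outer: "sum (?t M) (G - F (Suc k)) \<le> inverse (Suc k)"
      using tq[of M "G - F (Suc k)"] n(3)[of "G - F (Suc k)" k] G by fastforce
    show "sum (?t M) G \<le> 3 * inverse (Suc k)"
      using split inner mid outer by linarith
  qed simp
  obtain a where a: "0 < a" "\<And>h. a * (norm h)\<^sup>2 \<le> (ell2_norm I (\<lambda>i. cinner h (weaving M v w i)))\<^sup>2"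
    by (rule frame_bounds[OF weave[of M]]) (auto simp: M_def)
  obtain k where "inverse (real (Suc k)) < a / 3"
    using reals_Archimedean[of "a / 3"] a(1) by auto
  then show False using bound[of k] a(2)[of "f (n k)"] unit[of "n k"] by simp
qed

section \<open>Riesz bases and their coordinates\<close>

definition riesz_lower :: "'i set \<Rightarrow> ('i \<Rightarrow> 'a::complex_hilbert_space) \<Rightarrow> real \<Rightarrow> bool" where
  "riesz_lower I v a \<longleftrightarrow> 0 < a \<and> (\<forall>x F. finite F \<and> F \<subseteq> I \<longrightarrow>
     a * L2_set (\<lambda>i. cmod (x i)) F \<le> norm (\<Sum>i\<in>F. scaleC (x i) (v i)))"

lemma riesz_sequence_lower:
  assumes "is_riesz_sequence I v"
  obtains a where "riesz_lower I v a"
proof -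
  obtain a where a: "0 < a"
    "\<And>c. finite {i\<in>I. c i \<noteq> 0} \<Longrightarrow>
       a * ell2_norm I c \<le> norm (\<Sum>i\<in>{i\<in>I. c i \<noteq> 0}. scaleC (c i) (v i))"
    using assms unfolding is_riesz_sequence_def by blast
  have "a * L2_set (\<lambda>i. cmod (x i)) F \<le> norm (\<Sum>i\<in>F. scaleC (x i) (v i))"
    if F: "finite F" "F \<subseteq> I" for x F
  proof -
    define c where "c = (\<lambda>i. if i \<in> F then x i else 0)"
    have "{i\<in>I. c i \<noteq> 0} = {i\<in>F. x i \<noteq> 0}" using F by (auto simp: c_def)
    moreover have "ell2_norm I c = L2_set (\<lambda>i. cmod (x i)) F"
      using ell2_cutoff(2)[OF ell2_finite F(2)] F(1) by (simp add: c_def ell2_norm_finite)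
    moreover have "(\<Sum>i\<in>{i\<in>F. x i \<noteq> 0}. scaleC (c i) (v i)) = (\<Sum>i\<in>F. scaleC (x i) (v i))"
      using F(1) by (intro sum.mono_neutral_cong_left) (auto simp: c_def scaleC_zero_left)
    ultimately show ?thesis using a(2)[of c] F(1) by simp
  qed
  then show ?thesis using that[of a] a(1) by (simp add: riesz_lower_def)
qed

lemma riesz_series_lower:
  assumes "riesz_lower I v a" and sum: "((\<lambda>i. scaleC (x i) (v i)) has_sum g) I"
    and F: "finite F" "F \<subseteq> I"
  shows "a * L2_set (\<lambda>i. cmod (x i)) F \<le> norm g"
proof (rule tendsto_lowerbound[where F = "finite_subsets_at_top I"])
  show "((\<lambda>G. norm (\<Sum>i\<in>G. scaleC (x i) (v i))) \<longlongrightarrow> norm g) (finite_subsets_at_top I)"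
    using sum unfolding has_sum_def by (rule tendsto_norm)
  have a: "0 < a" using assms(1) by (simp add: riesz_lower_def)
  have "a * L2_set (\<lambda>i. cmod (x i)) F \<le> norm (\<Sum>i\<in>G. scaleC (x i) (v i))"
    if G: "finite G" "F \<subseteq> G" "G \<subseteq> I" for G
  proof -
    have "L2_set (\<lambda>i. cmod (x i)) F \<le> L2_set (\<lambda>i. cmod (x i)) G"
      unfolding L2_set_def using G by (intro real_sqrt_le_mono sum_mono2) auto
    then have "a * L2_set (\<lambda>i. cmod (x i)) F \<le> a * L2_set (\<lambda>i. cmod (x i)) G"
      using a by simp
    also have "\<dots> \<le> norm (\<Sum>i\<in>G. scaleC (x i) (v i))"
      using assms(1) G by (auto simp: riesz_lower_def)
    finally show ?thesis .
  qed
  then show "\<forall>\<^sub>F G in finite_subsets_at_top I.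
      a * L2_set (\<lambda>i. cmod (x i)) F \<le> norm (\<Sum>i\<in>G. scaleC (x i) (v i))"
    unfolding eventually_finite_subsets_at_top using F by blast
qed simp

lemma riesz_series_unique:
  assumes "riesz_lower I v a"
    and x: "((\<lambda>i. scaleC (x i) (v i)) has_sum g) I" and y: "((\<lambda>i. scaleC (y i) (v i)) has_sum g) I"
    and i: "i \<in> I"
  shows "x i = y i"
proof -
  have "((\<lambda>i. scaleC (x i) (v i) + - scaleC (y i) (v i)) has_sum (g + - g)) I"
    using y by (intro has_sum_add[OF x]) (simp add: has_sum_uminus)
  then have "((\<lambda>i. scaleC (x i - y i) (v i)) has_sum 0) I"
    by (simp add: scaleC_diff_left)
  from riesz_series_lower[OF assms(1) this, of "{i}"] show ?thesis
    using i assms(1) by (simp add: riesz_lower_def mult_le_0_iff)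
qed

text \<open>Write \<open>\<Sum> x\<^sub>i v\<^sub>i = S f\<close> with the frame operator \<open>S\<close>; since \<open>S f = \<Sum> \<langle>f, v\<^sub>i\<rangle> v\<^sub>i\<close> and the
  coefficients of such a series are unique, \<open>\<langle>f, v\<^sub>i\<rangle> = x\<^sub>i\<close>. With a unit sequence for \<open>x\<close> this
  yields the dual basis.\<close>

lemma riesz_basis_interpolation:
  assumes "is_riesz_basis I v" and x: "x \<in> ell2 I"
  obtains f where "\<And>i. i \<in> I \<Longrightarrow> cinner f (v i) = x i"
proof -
  have frame: "is_frame I v" using assms(1) by (simp add: is_riesz_basis_def)
  obtain a where a: "riesz_lower I v a"
    using assms(1) riesz_sequence_lower by (auto simp: is_riesz_basis_def)
  obtain b where b: "bessel I v b" using frame_bounds[OF frame] by metis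
  obtain f where "frame_operator I v f = (\<Sum>\<^sub>\<infinity>i\<in>I. scaleC (x i) (v i))"
    using frame_operator_surj[OF frame] by blast
  then have "((\<lambda>i. scaleC (x i) (v i)) has_sum frame_operator I v f) I"
    using has_sum_infsum[OF bessel_synthesis(1)[OF b x]] by simp
  then have "cinner f (v i) = x i" if "i \<in> I" for i
    by (rule riesz_series_unique[OF a frame_operator_has_sum[OF b] _ that])
  then show ?thesis by (rule that)
qed

lemma dual_vector_coordinate:
  assumes d: "\<And>j. j \<in> I \<Longrightarrow> cinner d (v j) = (if j = i then 1 else 0)" and i: "i \<in> I"
    and sum: "((\<lambda>j. scaleC (x j) (v j)) has_sum g) I"
  shows "cinner g d = x i"
proof -
  have "cinner (v j) d = (if j = i then 1 else 0)" if "j \<in> I" for j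
    using d[OF that] cinner_commute[of "v j" d] by simp
  then have "((\<lambda>j. x j * cinner (v j) d) has_sum x i) I"
    using i by (intro has_sum_finite_neutralI[of "{i}"]) auto
  then show ?thesis
    using has_sum_bounded_linear[OF bounded_linear_cinner_left sum, of d] has_sum_unique
    by (fastforce simp: cinner_scaleC_left)
qed

section \<open>The change of basis matrix\<close>

lemma change_of_basis_adjoint:
  assumes "is_change_of_basis_matrix I v w A" "i \<in> I"
  shows "((\<lambda>j. cnj (A j i) * cinner f (v j)) has_sum cinner f (w i)) I"
  using has_sum_bounded_linear[OF bounded_linear_cinner_right[of f],
      of "\<lambda>j. scaleC (A j i) (v j)" I "w i"] assms
  by (simp add: is_change_of_basis_matrix_def cinner_scaleC_right)

text \<open>For \<open>\<alpha> \<in> \<ell>\<^sup>2(J)\<close> the vector \<open>A \<alpha>\<close> lists the coordinates of \<open>\<Sum>\<^bsub>j \<in> J\<^esub> \<alpha>\<^sub>j w\<^sub>j\<close> with respect to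
  \<open>v\<close>; synthesis with \<open>w\<close> and extraction of coordinates are both bounded. Every central sub-matrix is
  a compression of \<open>A\<close>, so the upper estimate in the theorem is automatic.\<close>

lemma change_of_basis_matrix_bounded:
  fixes A :: "'i \<Rightarrow> 'i \<Rightarrow> complex"
  assumes v: "is_riesz_basis I v" and b: "bessel I w b" and A: "is_change_of_basis_matrix I v w A"
  obtains C where "0 < C" "\<And>J \<alpha>. J \<subseteq> I \<Longrightarrow> \<alpha> \<in> ell2 J \<Longrightarrow>
    \<exists>y. (\<forall>i\<in>I. ((\<lambda>j. A i j * \<alpha> j) has_sum y i) J) \<and>
      (\<forall>F. finite F \<and> F \<subseteq> I \<longrightarrow> L2_set (\<lambda>i. cmod (y i)) F \<le> C * ell2_norm J \<alpha>)"
proof -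
  have frame: "is_frame I v" using v by (simp add: is_riesz_basis_def)
  obtain a where a: "riesz_lower I v a"
    using v riesz_sequence_lower by (auto simp: is_riesz_basis_def)
  have a0: "0 < a" using a by (simp add: riesz_lower_def)
  have b0: "0 < b" by (rule bessel_pos[OF b])
  obtain b' where b': "bessel I v b'" using frame_bounds[OF frame] by metis
  have "\<exists>y. (\<forall>i\<in>I. ((\<lambda>j. A i j * \<alpha> j) has_sum y i) J) \<and>
      (\<forall>F. finite F \<and> F \<subseteq> I \<longrightarrow> L2_set (\<lambda>i. cmod (y i)) F \<le> sqrt b / a * ell2_norm J \<alpha>)"
    if J: "J \<subseteq> I" and \<alpha>: "\<alpha> \<in> ell2 J" for J and \<alpha> :: "'i \<Rightarrow> complex"
  proof -
    have bJ: "bessel J w b" using b J by (auto simp: bessel_def)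
    define g where "g = (\<Sum>\<^sub>\<infinity>j\<in>J. scaleC (\<alpha> j) (w j))"
    have g: "((\<lambda>j. scaleC (\<alpha> j) (w j)) has_sum g) J"
      unfolding g_def by (intro has_sum_infsum bessel_synthesis(1)[OF bJ \<alpha>])
    have "(norm g)\<^sup>2 \<le> (sqrt b * ell2_norm J \<alpha>)\<^sup>2"
      using bessel_synthesis(2)[OF bJ \<alpha>] b0 by (simp add: g_def power_mult_distrib)
    then have normg: "norm g \<le> sqrt b * ell2_norm J \<alpha>"
      by (rule power2_le_imp_le) (simp add: ell2_norm_nonneg b0 less_imp_le)
    obtain f where "frame_operator I v f = g" using frame_operator_surj[OF frame] by blast
    then have y: "((\<lambda>i. scaleC (cinner f (v i)) (v i)) has_sum g) I"
      using frame_operator_has_sum[OF b'] by blast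
    show ?thesis
    proof (intro exI[of _ "\<lambda>i. cinner f (v i)"] conjI ballI allI impI)
      fix i assume i: "i \<in> I"
      have "(\<lambda>j. if j \<in> {i} then 1 else 0 :: complex) \<in> ell2 I"
        using i by (intro ell2_cutoff(1) ell2_finite) auto
      then obtain d where d: "\<And>j. j \<in> I \<Longrightarrow> cinner d (v j) = (if j = i then 1 else 0)"
        using riesz_basis_interpolation[OF v, of "\<lambda>j. if j \<in> {i} then 1 else 0"] by auto
      have "((\<lambda>j. \<alpha> j * cinner (w j) d) has_sum cinner g d) J"
        using has_sum_bounded_linear[OF bounded_linear_cinner_left g, of d]
        by (simp add: cinner_scaleC_left)
      moreover have "cinner (w j) d = A i j" if "j \<in> J" for j
        using A J that by (intro dual_vector_coordinate[OF d i])
          (auto simp: is_change_of_basis_matrix_def)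
      ultimately have "((\<lambda>j. A i j * \<alpha> j) has_sum cinner g d) J"
        by (simp add: mult.commute cong: has_sum_cong)
      then show "((\<lambda>j. A i j * \<alpha> j) has_sum cinner f (v i)) J"
        using dual_vector_coordinate[OF d i y] by simp
    next
      fix F assume "finite F \<and> F \<subseteq> I"
      then have "a * L2_set (\<lambda>i. cmod (cinner f (v i))) F \<le> norm g"
        by (intro riesz_series_lower[OF a y]) auto
      then show "L2_set (\<lambda>i. cmod (cinner f (v i))) F \<le> sqrt b / a * ell2_norm J \<alpha>"
        using normg a0 by (simp add: field_simps)
    qed
  qed
  then show ?thesis using that[of "sqrt b / a"] a0 b0 by simp
qed

lemma finitely_supported_coefficients:
  assumes v: "is_riesz_basis I v" and A: "is_change_of_basis_matrix I v w A"
    and F: "finite F" "F \<subseteq> I"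
  obtains f where "\<And>i. i \<in> I \<Longrightarrow> cinner f (v i) = (if i \<in> F then x i else 0)"
    "\<And>i. i \<in> I \<Longrightarrow> cinner f (w i) = (\<Sum>j\<in>F. cnj (A j i) * x j)"
proof -
  have x: "(\<lambda>i. if i \<in> F then x i else 0) \<in> ell2 I"
    using F by (intro ell2_cutoff(1) ell2_finite)
  obtain f where f: "\<And>i. i \<in> I \<Longrightarrow> cinner f (v i) = (if i \<in> F then x i else 0)"
    by (rule riesz_basis_interpolation[OF v x]) (rule that)
  have "cinner f (w i) = (\<Sum>j\<in>F. cnj (A j i) * x j)" if "i \<in> I" for i
  proof -
    have "((\<lambda>j. cnj (A j i) * cinner f (v j)) has_sum (\<Sum>j\<in>F. cnj (A j i) * x j)) I"
      using F by (intro has_sum_finite_neutralI[of F]) (auto simp: f subset_iff intro!: sum.cong)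
    then show ?thesis using change_of_basis_adjoint[OF A that] has_sum_unique by blast
  qed
  then show ?thesis using f that by blast
qed

section \<open>Lower bounds of a finite square matrix and of its adjoint\<close>

text \<open>The columns are linearly independent and as many as the unit vectors, so they span the space
  of functions supported on \<open>K\<close>.\<close>

lemma injective_square_matrix_surj:
  fixes M :: "'i \<Rightarrow> 'i \<Rightarrow> 'f::field"
  assumes K: "finite K"
    and inj: "\<And>x. (\<And>i. i \<in> K \<Longrightarrow> (\<Sum>j\<in>K. M i j * x j) = 0) \<Longrightarrow> (\<And>j. j \<in> K \<Longrightarrow> x j = 0)"
  shows "\<exists>x. \<forall>i\<in>K. (\<Sum>j\<in>K. M i j * x j) = y i"
proof -
  interpret vs: vector_space "\<lambda>(c::'f) (f::'i \<Rightarrow> 'f) i. c * f i"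
    by standard (auto simp: fun_eq_iff algebra_simps)
  have sum_apply: "(\<Sum>j\<in>S. h j) i = (\<Sum>j\<in>S. h j i)" for S and h :: "'c \<Rightarrow> 'i \<Rightarrow> 'f" and i
    by (induction S rule: infinite_finite_induct) auto
  define col where "col j = (\<lambda>i. if i \<in> K then M i j else 0)" for j
  define e :: "'i \<Rightarrow> 'i \<Rightarrow> 'f" where "e j = (\<lambda>i. if i = j then 1 else 0)" for j
  define z where "z = (\<lambda>i. if i \<in> K then y i else 0)"
  have inj_col: "inj_on col K"
  proof (rule inj_onI, rule ccontr)
    fix j k assume jk: "j \<in> K" "k \<in> K" "col j = col k" "j \<noteq> k"
    have "(\<Sum>l\<in>K. M i l * (if l = j then 1 else if l = k then - 1 else 0)) = 0" if "i \<in> K" for i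
    proof -
      have "(\<Sum>l\<in>K. M i l * (if l = j then 1 else if l = k then - 1 else 0))
          = (\<Sum>l\<in>K. (if l = j then M i j else 0) - (if l = k then M i k else 0))"
        using jk(4) by (intro sum.cong) auto
      also have "\<dots> = M i j - M i k" using K jk(1,2) by (simp add: sum_subtractf)
      also have "\<dots> = 0" using fun_cong[OF jk(3), of i] that by (simp add: col_def)
      finally show ?thesis .
    qed
    from inj[OF this jk(1)] show False by simp
  qed
  have indep: "vs.independent (col ` K)"
  proof (rule vs.independent_if_scalars_zero)
    fix u x assume u: "(\<Sum>x\<in>col ` K. (\<lambda>i. u x * x i)) = 0" and x: "x \<in> col ` K"
    have "(\<Sum>j\<in>K. M i j * u (col j)) = 0" if "i \<in> K" for i
    proof -
      have "(\<Sum>j\<in>K. M i j * u (col j)) = (\<Sum>j\<in>K. u (col j) * col j i)"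
        using that by (intro sum.cong) (auto simp: col_def)
      also have "\<dots> = (\<Sum>x\<in>col ` K. (\<lambda>i. u x * x i)) i"
        by (simp add: sum_apply sum.reindex[OF inj_col])
      finally show ?thesis by (simp add: u)
    qed
    from inj[OF this] show "u x = 0" using x by auto
  qed (simp add: K)
  have in_span: "h \<in> vs.span (e ` K)" if "\<And>i. i \<notin> K \<Longrightarrow> h i = 0" for h
  proof -
    have "h = (\<Sum>j\<in>K. (\<lambda>i. h j * e j i))"
    proof
      fix i show "h i = (\<Sum>j\<in>K. (\<lambda>i. h j * e j i)) i"
        using K that[of i] by (simp add: sum_apply e_def if_distrib cong: if_cong)
    qed
    also have "\<dots> \<in> vs.span (e ` K)"
      by (intro vs.span_sum vs.span_scale vs.span_base) auto
    finally show ?thesis .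
  qed
  have "z \<in> vs.span (col ` K)"
  proof (rule ccontr)
    assume z: "z \<notin> vs.span (col ` K)"
    have "vs.independent (insert z (col ` K))"
      using indep z by (rule vs.independent_insertI[rotated])
    moreover have "insert z (col ` K) \<subseteq> vs.span (e ` K)"
      by (auto intro!: in_span simp: z_def col_def)
    ultimately have "card (insert z (col ` K)) \<le> card (e ` K)"
      using vs.independent_span_bound[of "e ` K"] K by blast
    also have "\<dots> \<le> card K" by (rule card_image_le[OF K])
    finally show False
      using z K by (simp add: card_image[OF inj_col] vs.span_base card_insert_if split: if_splits)
  qed
  then obtain u where u: "z = (\<Sum>x\<in>col ` K. (\<lambda>i. u x * x i))"
    using K by (auto simp: vs.span_finite)
  have "(\<Sum>j\<in>K. M i j * u (col j)) = y i" if "i \<in> K" for i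
  proof -
    have "y i = z i" using that by (simp add: z_def)
    also have "\<dots> = (\<Sum>j\<in>K. u (col j) * col j i)"
      unfolding u by (simp add: sum_apply sum.reindex[OF inj_col])
    also have "\<dots> = (\<Sum>j\<in>K. M i j * u (col j))"
      using that by (intro sum.cong) (auto simp: col_def)
    finally show ?thesis by simp
  qed
  then show ?thesis by (intro exI[of _ "\<lambda>j. u (col j)"] ballI)
qed

definition matrix_lower :: "'i set \<Rightarrow> ('i \<Rightarrow> 'i \<Rightarrow> complex) \<Rightarrow> real \<Rightarrow> bool" where
  "matrix_lower K M c \<longleftrightarrow> (\<forall>x. c * L2_set (\<lambda>i. cmod (x i)) K
     \<le> L2_set (\<lambda>i. cmod (\<Sum>j\<in>K. M i j * x j)) K)"

text \<open>A finite square matrix that is bounded below by \<open>c\<close> is invertible with inverse of norm at most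
  \<open>1 / c\<close>, and the inverse of the adjoint has the same norm. Concretely, solve \<open>M x = \<alpha>\<close>: then
  \<open>\<parallel>\<alpha>\<parallel>\<^sup>2 = \<langle>\<alpha>, M x\<rangle> = \<langle>M\<^sup>* \<alpha>, x\<rangle> \<le> \<parallel>M\<^sup>* \<alpha>\<parallel> \<parallel>x\<parallel>\<close> and \<open>c \<parallel>x\<parallel> \<le> \<parallel>\<alpha>\<parallel>\<close>. Squareness is essential for
  solvability, so the statement has no direct analogue for infinite \<open>K\<close>.\<close>

lemma matrix_lower_adjoint:
  assumes K: "finite K" and c: "0 < c" and lower: "matrix_lower K M c"
  shows "matrix_lower K (\<lambda>i j. cnj (M j i)) c"
  unfolding matrix_lower_def
proof
  fix \<alpha> :: "'a \<Rightarrow> complex"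
  have inj: "x j = 0" if "\<And>i. i \<in> K \<Longrightarrow> (\<Sum>j\<in>K. M i j * x j) = 0" "j \<in> K" for x j
  proof -
    have "L2_set (\<lambda>i. cmod (\<Sum>j\<in>K. M i j * x j)) K = 0" using that(1) by (intro L2_set_0') simp
    moreover have "c * L2_set (\<lambda>i. cmod (x i)) K \<le> L2_set (\<lambda>i. cmod (\<Sum>j\<in>K. M i j * x j)) K"
      using lower by (simp add: matrix_lower_def)
    ultimately have "L2_set (\<lambda>i. cmod (x i)) K = 0"
      using c L2_set_nonneg[of "\<lambda>i. cmod (x i)" K] by (simp add: mult_le_0_iff)
    then show ?thesis using K that(2) by (simp add: L2_set_eq_0_iff)
  qed
  obtain x where x: "\<And>i. i \<in> K \<Longrightarrow> (\<Sum>j\<in>K. M i j * x j) = \<alpha> i"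
    using injective_square_matrix_surj[OF K, of M \<alpha>] inj by metis
  define X where "X = L2_set (\<lambda>i. cmod (x i)) K"
  define Y where "Y = L2_set (\<lambda>i. cmod (\<alpha> i)) K"
  define Z where "Z = L2_set (\<lambda>i. cmod (\<Sum>j\<in>K. cnj (M j i) * \<alpha> j)) K"
  have "c * X \<le> L2_set (\<lambda>i. cmod (\<Sum>j\<in>K. M i j * x j)) K"
    using lower by (simp add: matrix_lower_def X_def)
  also have "\<dots> = Y" unfolding Y_def by (rule L2_set_cong) (simp_all add: x)
  finally have X: "c * X \<le> Y" .
  have "complex_of_real (Y\<^sup>2) = (\<Sum>i\<in>K. \<alpha> i * cnj (\<alpha> i))"
    by (simp add: Y_def L2_set_squared complex_norm_square del: of_real_power)
  also have "\<dots> = (\<Sum>i\<in>K. \<Sum>j\<in>K. M i j * x j * cnj (\<alpha> i))"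
    by (intro sum.cong refl) (simp add: x[symmetric] sum_distrib_right)
  also have "\<dots> = (\<Sum>j\<in>K. \<Sum>i\<in>K. M i j * x j * cnj (\<alpha> i))" by (rule sum.swap)
  also have "\<dots> = (\<Sum>j\<in>K. x j * cnj (\<Sum>i\<in>K. cnj (M i j) * \<alpha> i))"
    by (intro sum.cong refl) (simp add: sum_distrib_left mult_ac)
  finally have "Y\<^sup>2 = cmod (\<Sum>j\<in>K. x j * cnj (\<Sum>i\<in>K. cnj (M i j) * \<alpha> i))"
    by (metis abs_of_nonneg norm_of_real zero_le_power2)
  also have "\<dots> \<le> X * Z"
    using cmod_sum_mult_le[of x "\<lambda>j. cnj (\<Sum>i\<in>K. cnj (M i j) * \<alpha> i)" K]
    by (simp add: X_def Z_def del: cnj_sum)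
  finally have "c * Y\<^sup>2 \<le> (c * X) * Z" using c by (simp add: mult.assoc)
  also have "\<dots> \<le> Y * Z" using X by (rule mult_right_mono) (simp add: Z_def)
  finally have "Y * (c * Y) \<le> Y * Z" by (simp add: power2_eq_square mult_ac)
  moreover have "0 \<le> Y" "0 \<le> Z" by (simp_all add: Y_def Z_def)
  ultimately have "c * Y \<le> Z" by (cases "Y = 0") auto
  then show "c * L2_set (\<lambda>i. cmod (\<alpha> i)) K \<le> L2_set (\<lambda>i. cmod (\<Sum>j\<in>K. cnj (M j i) * \<alpha> j)) K"
    by (simp add: Y_def Z_def)
qed

section \<open>From finite to infinite index sets\<close>

text \<open>Both implications compare a finite sub-matrix with an infinite one, at the cost of an error
  proportional to the \<open>\<ell>\<^sup>2\<close> norm of \<open>x\<close> off the finite set. The constant \<open>R\<close> is the share of that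
  error that does not vanish in the limit.\<close>

lemma lower_bound_limit:
  assumes x: "x \<in> ell2 K" and R: "0 \<le> R"
    and finite: "\<And>F. finite F \<Longrightarrow> F \<subseteq> K \<Longrightarrow>
      c * L2_set (\<lambda>i. cmod (x i)) F \<le> P + d * sqrt (R\<^sup>2 + (ell2_norm (K - F) x)\<^sup>2)"
  shows "c * ell2_norm K x \<le> P + d * R"
proof (rule tendsto_le[where F = "finite_subsets_at_top K"])
  let ?q = "\<lambda>i. (cmod (x i))\<^sup>2"
  have sum: "(sum ?q \<longlongrightarrow> (ell2_norm K x)\<^sup>2) (finite_subsets_at_top K)"
    unfolding ell2_norm_squared has_sum_def[symmetric]
    using x by (simp add: ell2_def)
  have "((\<lambda>F. c * sqrt (sum ?q F)) \<longlongrightarrow> c * sqrt ((ell2_norm K x)\<^sup>2)) (finite_subsets_at_top K)"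
    by (intro tendsto_intros sum)
  then show "((\<lambda>F. c * L2_set (\<lambda>i. cmod (x i)) F) \<longlongrightarrow> c * ell2_norm K x) (finite_subsets_at_top K)"
    by (simp add: L2_set_def ell2_norm_nonneg)
  have "((\<lambda>F. P + d * sqrt (R\<^sup>2 + ((ell2_norm K x)\<^sup>2 - sum ?q F)))
      \<longlongrightarrow> P + d * sqrt (R\<^sup>2 + ((ell2_norm K x)\<^sup>2 - (ell2_norm K x)\<^sup>2))) (finite_subsets_at_top K)"
    by (intro tendsto_intros sum)
  then show "((\<lambda>F. P + d * sqrt (R\<^sup>2 + ((ell2_norm K x)\<^sup>2 - sum ?q F))) \<longlongrightarrow> P + d * R)
      (finite_subsets_at_top K)"
    by (simp add: R)
  have "c * L2_set (\<lambda>i. cmod (x i)) F \<le> P + d * sqrt (R\<^sup>2 + ((ell2_norm K x)\<^sup>2 - sum ?q F))"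
    if F: "finite F" "F \<subseteq> K" for F
  proof -
    have "(ell2_norm K x)\<^sup>2 - sum ?q F = (ell2_norm (K - F) x)\<^sup>2"
      using ell2_norm_split[OF x F(2)] F(1) by (simp add: ell2_norm_finite L2_set_squared)
    then show ?thesis using finite[OF F] by simp
  qed
  then show "\<forall>\<^sub>F F in finite_subsets_at_top K.
      c * L2_set (\<lambda>i. cmod (x i)) F \<le> P + d * sqrt (R\<^sup>2 + ((ell2_norm K x)\<^sup>2 - sum ?q F))"
    by (intro eventually_finite_subsets_at_top_weakI)
qed simp

section \<open>The two implications\<close>

text \<open>A vector \<open>f\<close> whose coefficients along \<open>v\<close> are \<open>x\<close> on \<open>K\<close> and zero elsewhere has coefficients
  along \<open>w\<close> given by \<open>A\<^sup>* x\<close>. Testing the weaving that uses \<open>w\<close> exactly on \<open>K\<close> with this \<open>f\<close> isolates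
  \<open>(A\<^sub>K)\<^sup>* x\<close>; finiteness of \<open>K\<close> then permits the passage to \<open>A\<^sub>K\<close>.\<close>

lemma woven_finite_submatrices_lower:
  assumes v: "is_riesz_basis I v" and A: "is_change_of_basis_matrix I v w A"
    and c: "0 < c"
    and lower: "\<And>J f. J \<subseteq> I \<Longrightarrow> c * (norm f)\<^sup>2 \<le> (ell2_norm I (\<lambda>i. cinner f (weaving J v w i)))\<^sup>2"
  obtains s where "0 < s" "\<And>K. finite K \<Longrightarrow> K \<subseteq> I \<Longrightarrow> matrix_lower K A s"
proof -
  obtain b where b: "bessel I v b"
    using v frame_bounds[of I v] by (auto simp: is_riesz_basis_def)
  have b0: "0 < b" by (rule bessel_pos[OF b])
  define s where "s = sqrt (c / b)"
  have s: "0 < s" using b0 c by (simp add: s_def)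
  have "matrix_lower K A s" if K: "finite K" "K \<subseteq> I" for K
  proof -
    have "s * L2_set (\<lambda>i. cmod (x i)) K \<le> L2_set (\<lambda>i. cmod (\<Sum>j\<in>K. cnj (A j i) * x j)) K"
      (is "_ \<le> L2_set ?y K") for x
    proof -
      obtain f where f: "\<And>i. i \<in> I \<Longrightarrow> cinner f (v i) = (if i \<in> K then x i else 0)"
        "\<And>i. i \<in> I \<Longrightarrow> cinner f (w i) = (\<Sum>j\<in>K. cnj (A j i) * x j)"
        by (rule finitely_supported_coefficients[OF v A K]) (rule that)
      have "(L2_set (\<lambda>i. cmod (x i)) K)\<^sup>2 = (\<Sum>i\<in>K. (cmod (cinner f (v i)))\<^sup>2)"
        unfolding L2_set_squared using K(2) by (intro sum.cong) (auto simp: f)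
      also have "\<dots> \<le> b * (norm f)\<^sup>2" by (rule besselD[OF b K])
      finally have x: "(L2_set (\<lambda>i. cmod (x i)) K)\<^sup>2 \<le> b * (norm f)\<^sup>2" .
      have "ell2_norm I (\<lambda>i. cinner f (weaving (I - K) v w i))
          = ell2_norm I (\<lambda>i. if i \<in> K then \<Sum>j\<in>K. cnj (A j i) * x j else 0)"
        by (rule ell2_norm_cong) (auto simp: weaving_def f)
      also have "\<dots> = L2_set ?y K"
        using K by (subst ell2_cutoff(2)) (auto simp: ell2_finite ell2_norm_finite)
      finally have "c * (norm f)\<^sup>2 \<le> (L2_set ?y K)\<^sup>2"
        using lower[of "I - K" f] by simp
      have "(s * L2_set (\<lambda>i. cmod (x i)) K)\<^sup>2 = c / b * (L2_set (\<lambda>i. cmod (x i)) K)\<^sup>2"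
        using b0 c by (simp add: s_def power_mult_distrib)
      also have "\<dots> \<le> c / b * (b * (norm f)\<^sup>2)"
        using x b0 c by (intro mult_left_mono) auto
      also have "\<dots> \<le> (L2_set ?y K)\<^sup>2"
        using \<open>c * (norm f)\<^sup>2 \<le> (L2_set ?y K)\<^sup>2\<close> b0 by simp
      finally show ?thesis by (rule power2_le_imp_le) simp
    qed
    then have "matrix_lower K (\<lambda>i j. cnj (A j i)) s" by (simp add: matrix_lower_def)
    from matrix_lower_adjoint[OF K(1) s this] show ?thesis by simp
  qed
  then show ?thesis using that s by blast
qed

text \<open>The upper estimate is the boundedness of \<open>A\<close>; the lower estimate passes from finite to
  arbitrary index sets because \<open>A\<close> is bounded.\<close>

lemma finite_submatrices_lower_imp_unif:
  assumes v: "is_riesz_basis I v" and b: "bessel I w b" and A: "is_change_of_basis_matrix I v w A"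
    and s: "0 < s" and lower: "\<And>K. finite K \<Longrightarrow> K \<subseteq> I \<Longrightarrow> matrix_lower K A s"
  shows "central_submatrices_unif_bdd_invertible I A"
proof -
  obtain C where C: "0 < C" and bounded: "\<And>J \<alpha>. J \<subseteq> I \<Longrightarrow> \<alpha> \<in> ell2 J \<Longrightarrow>
    \<exists>y. (\<forall>i\<in>I. ((\<lambda>j. A i j * \<alpha> j) has_sum y i) J) \<and>
      (\<forall>F. finite F \<and> F \<subseteq> I \<longrightarrow> L2_set (\<lambda>i. cmod (y i)) F \<le> C * ell2_norm J \<alpha>)"
    using change_of_basis_matrix_bounded[OF v b A] by blast
  have main: "(\<forall>i\<in>J. (\<lambda>j. A i j * \<alpha> j) summable_on J) \<and> central_mult A J \<alpha> \<in> ell2 J \<and>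
     s\<^sup>2 * (ell2_norm J \<alpha>)\<^sup>2 \<le> (ell2_norm J (central_mult A J \<alpha>))\<^sup>2 \<and>
     (ell2_norm J (central_mult A J \<alpha>))\<^sup>2 \<le> C\<^sup>2 * (ell2_norm J \<alpha>)\<^sup>2"
    if J: "J \<subseteq> I" and \<alpha>: "\<alpha> \<in> ell2 J" for J \<alpha>
  proof -
    obtain y where y: "\<And>i. i \<in> I \<Longrightarrow> ((\<lambda>j. A i j * \<alpha> j) has_sum y i) J"
      "\<And>F. finite F \<Longrightarrow> F \<subseteq> I \<Longrightarrow> L2_set (\<lambda>i. cmod (y i)) F \<le> C * ell2_norm J \<alpha>"
      using bounded[OF J \<alpha>] by blast
    have summable: "\<forall>i\<in>J. (\<lambda>j. A i j * \<alpha> j) summable_on J"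
      using y(1) J by (auto intro: has_sum_imp_summable)
    have cm: "central_mult A J \<alpha> i = y i" if "i \<in> J" for i
      using infsumI[OF y(1), of i] that J by (auto simp: central_mult_def)
    have fin: "(\<Sum>i\<in>F. (cmod (central_mult A J \<alpha> i))\<^sup>2) \<le> C\<^sup>2 * (ell2_norm J \<alpha>)\<^sup>2"
      if "finite F" "F \<subseteq> J" for F
    proof -
      have "(\<Sum>i\<in>F. (cmod (central_mult A J \<alpha> i))\<^sup>2) = (\<Sum>i\<in>F. (cmod (y i))\<^sup>2)"
        using that cm by (intro sum.cong) auto
      also have "\<dots> \<le> (C * ell2_norm J \<alpha>)\<^sup>2"
        using y(2)[of F] that J C by (subst L2_set_le_iff[symmetric]) (auto simp: ell2_norm_nonneg)
      finally show ?thesis by (simp add: power_mult_distrib)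
    qed
    have cm_ell2: "central_mult A J \<alpha> \<in> ell2 J"
      unfolding ell2_def mem_Collect_eq by (rule nonneg_infsum_le(1)[OF _ fin]) auto
    have upper: "(ell2_norm J (central_mult A J \<alpha>))\<^sup>2 \<le> C\<^sup>2 * (ell2_norm J \<alpha>)\<^sup>2"
      unfolding ell2_norm_squared[of J "central_mult A J \<alpha>"]
      by (rule nonneg_infsum_le(2)[OF _ fin]) auto
    \<comment> \<open>On a finite \<open>F \<subseteq> J\<close> the vector \<open>A\<^sub>F \<alpha>\<close> differs from \<open>A\<^sub>J \<alpha>\<close> by \<open>A\<close> applied to the part of
        \<open>\<alpha>\<close> off \<open>F\<close>, which is small once \<open>F\<close> is large.\<close>
    have "s * L2_set (\<lambda>i. cmod (\<alpha> i)) F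
        \<le> ell2_norm J (central_mult A J \<alpha>) + C * sqrt (0\<^sup>2 + (ell2_norm (J - F) \<alpha>)\<^sup>2)"
      if F: "finite F" "F \<subseteq> J" for F
    proof -
      have "J - F \<subseteq> I" "\<alpha> \<in> ell2 (J - F)" using J ell2_mono[OF \<alpha>] by auto
      moreover have "F \<subseteq> I" using F J by auto
      ultimately obtain z where z: "\<And>i. i \<in> I \<Longrightarrow> ((\<lambda>j. A i j * \<alpha> j) has_sum z i) (J - F)"
        "L2_set (\<lambda>i. cmod (z i)) F \<le> C * ell2_norm (J - F) \<alpha>"
        using bounded[of "J - F" \<alpha>] F(1) by blast
      have split: "(\<Sum>j\<in>F. A i j * \<alpha> j) = central_mult A J \<alpha> i + - z i" if "i \<in> F" for i
      proof -
        have i: "i \<in> I" "i \<in> J" using that F J by auto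
        have "((\<lambda>j. A i j * \<alpha> j) has_sum ((\<Sum>j\<in>F. A i j * \<alpha> j) + z i)) (F \<union> (J - F))"
          using F z(1)[OF i(1)] by (intro has_sum_Un_disjoint has_sum_finite) auto
        moreover have "F \<union> (J - F) = J" using F by auto
        ultimately have "(\<Sum>j\<in>F. A i j * \<alpha> j) + z i = y i"
          using y(1)[OF i(1)] has_sum_unique by fastforce
        then show ?thesis using cm[OF i(2)] by (simp add: eq_diff_eq)
      qed
      have "s * L2_set (\<lambda>i. cmod (\<alpha> i)) F \<le> L2_set (\<lambda>i. cmod (\<Sum>j\<in>F. A i j * \<alpha> j)) F"
        using lower[of F] F J by (auto simp: matrix_lower_def)
      also have "\<dots> = L2_set (\<lambda>i. cmod (central_mult A J \<alpha> i + - z i)) F"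
        by (rule L2_set_cong) (simp_all add: split)
      also have "\<dots> \<le> L2_set (\<lambda>i. cmod (central_mult A J \<alpha> i)) F + L2_set (\<lambda>i. cmod (- z i)) F"
        by (rule L2_set_cmod_add_le)
      also have "L2_set (\<lambda>i. cmod (central_mult A J \<alpha> i)) F \<le> ell2_norm J (central_mult A J \<alpha>)"
        using ell2_finite_sum_le[OF cm_ell2 F] by (simp add: L2_set_le_iff ell2_norm_nonneg)
      finally show ?thesis using z(2) by (simp add: ell2_norm_nonneg)
    qed
    then have "s * ell2_norm J \<alpha> \<le> ell2_norm J (central_mult A J \<alpha>) + C * 0"
      by (intro lower_bound_limit[OF \<alpha>]) auto
    then have "(s * ell2_norm J \<alpha>)\<^sup>2 \<le> (ell2_norm J (central_mult A J \<alpha>))\<^sup>2"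
      using s by (intro power_mono) (auto simp: ell2_norm_nonneg)
    then show ?thesis using summable cm_ell2 upper by (simp add: power_mult_distrib)
  qed
  show ?thesis
    unfolding central_submatrices_unif_bdd_invertible_def
  proof (rule exI[of _ "s\<^sup>2"], rule conjI)
    show "0 < s\<^sup>2" using s by simp
    show "\<exists>C2>0. \<forall>J\<subseteq>I. \<forall>\<alpha>\<in>ell2 J. (\<forall>i\<in>J. (\<lambda>j. A i j * \<alpha> j) summable_on J) \<and>
        central_mult A J \<alpha> \<in> ell2 J \<and>
        s\<^sup>2 * (ell2_norm J \<alpha>)\<^sup>2 \<le> (ell2_norm J (central_mult A J \<alpha>))\<^sup>2 \<and>
        (ell2_norm J (central_mult A J \<alpha>))\<^sup>2 \<le> C2 * (ell2_norm J \<alpha>)\<^sup>2"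
      using main C by (intro exI[of _ "C\<^sup>2"] conjI allI impI ballI) simp_all
  qed
qed

lemma unif_imp_finite_submatrices_lower:
  assumes "central_submatrices_unif_bdd_invertible I A"
  obtains s where "0 < s" "\<And>K. finite K \<Longrightarrow> K \<subseteq> I \<Longrightarrow> matrix_lower K A s"
proof -
  obtain C where C: "0 < C" "\<And>J \<alpha>. J \<subseteq> I \<Longrightarrow> \<alpha> \<in> ell2 J \<Longrightarrow>
      C * (ell2_norm J \<alpha>)\<^sup>2 \<le> (ell2_norm J (central_mult A J \<alpha>))\<^sup>2"
    using assms unfolding central_submatrices_unif_bdd_invertible_def by blast
  have "matrix_lower K A (sqrt C)" if K: "finite K" "K \<subseteq> I" for K
    unfolding matrix_lower_def
  proof
    fix x
    have "(sqrt C * L2_set (\<lambda>i. cmod (x i)) K)\<^sup>2 \<le> (L2_set (\<lambda>i. cmod (central_mult A K x i)) K)\<^sup>2"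
      using C(2)[OF K(2) ell2_finite[OF K(1)], of x] C(1) K(1)
      by (simp add: power_mult_distrib ell2_norm_finite)
    then have "sqrt C * L2_set (\<lambda>i. cmod (x i)) K \<le> L2_set (\<lambda>i. cmod (central_mult A K x i)) K"
      by (rule power2_le_imp_le) simp
    then show "sqrt C * L2_set (\<lambda>i. cmod (x i)) K \<le> L2_set (\<lambda>i. cmod (\<Sum>j\<in>K. A i j * x j)) K"
      using K(1) by (simp add: central_mult_def)
  qed
  then show ?thesis using that[of "sqrt C"] C(1) by simp
qed

text \<open>Let \<open>x\<close> and \<open>y = A\<^sup>* x\<close> be the coefficients of \<open>f\<close> along \<open>v\<close> and \<open>w\<close>, and let the weaving use
  \<open>w\<close> on \<open>K = I - J\<close>. It controls \<open>x\<close> on \<open>J\<close> and \<open>y\<close> on \<open>K\<close>. On \<open>K\<close> one has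
  \<open>y = (A\<^sub>K)\<^sup>* (x\<^sub>K) + (A\<^sup>* x\<^sub>J)\<^sub>K\<close>, so the lower bound of \<open>(A\<^sub>K)\<^sup>*\<close>, which is inherited from finite
  subsets of \<open>K\<close>, controls \<open>x\<close> on \<open>K\<close> as well.\<close>

lemma finite_submatrices_lower_imp_frame:
  assumes v: "is_riesz_basis I v" and w: "is_frame I w" and A: "is_change_of_basis_matrix I v w A"
    and s: "0 < s" and lower: "\<And>K. finite K \<Longrightarrow> K \<subseteq> I \<Longrightarrow> matrix_lower K A s"
    and J: "J \<subseteq> I"
  shows "is_frame I (weaving J v w)"
proof -
  obtain a b where a: "0 < a" and b: "bessel I v b"
    and va: "\<And>f. a * (norm f)\<^sup>2 \<le> (ell2_norm I (\<lambda>i. cinner f (v i)))\<^sup>2"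
    using v frame_bounds[of I v] by (auto simp: is_riesz_basis_def)
  obtain b' where b': "bessel I w b'" using frame_bounds[OF w] by metis
  have b0: "0 < b'" by (rule bessel_pos[OF b'])
  define K where "K = I - J"
  have KI: "K \<subseteq> I" using J by (auto simp: K_def)
  define d where "d = sqrt (b' / a)"
  have d: "0 \<le> d" using a b0 by (simp add: d_def)
  define q where "q = 1 + ((1 + d) / s)\<^sup>2"
  have q: "0 < q" unfolding q_def by (rule add_pos_nonneg) auto
  have "a / q * (norm f)\<^sup>2 \<le> (ell2_norm I (\<lambda>i. cinner f (weaving J v w i)))\<^sup>2" for f
  proof -
    define x where "x i = cinner f (v i)" for i
    define y where "y i = cinner f (w i)" for i
    define R where "R = ell2_norm J x"
    define P where "P = ell2_norm K y"
    define T where "T = ell2_norm I (\<lambda>i. cinner f (weaving J v w i))"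
    have x: "x \<in> ell2 I" unfolding x_def by (rule bessel_coeffs_ell2(1)[OF b])
    have y: "y \<in> ell2 I" unfolding y_def by (rule bessel_coeffs_ell2(1)[OF b'])
    have xK: "x \<in> ell2 K" by (rule ell2_mono[OF x KI])
    have yK: "y \<in> ell2 K" by (rule ell2_mono[OF y KI])
    have T: "T\<^sup>2 = R\<^sup>2 + P\<^sup>2"
    proof -
      have "ell2_norm J (\<lambda>i. cinner f (weaving J v w i)) = R"
        unfolding R_def by (rule ell2_norm_cong) (simp add: weaving_def x_def)
      moreover have "ell2_norm (I - J) (\<lambda>i. cinner f (weaving J v w i)) = P"
        unfolding P_def K_def by (rule ell2_norm_cong) (simp add: weaving_def y_def)
      ultimately show ?thesis
        using ell2_norm_split[OF bessel_coeffs_ell2(1)[OF bessel_weaving[OF b b']] J] by (simp add: T_def)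
    qed
    have nonneg: "0 \<le> R" "0 \<le> P" "0 \<le> T"
      by (simp_all add: R_def P_def T_def ell2_norm_nonneg)
    have RT: "R \<le> T" and PT: "P \<le> T"
      using T nonneg by (auto intro: power2_le_imp_le)
    have "s * L2_set (\<lambda>i. cmod (x i)) F \<le> P + d * sqrt (R\<^sup>2 + (ell2_norm (K - F) x)\<^sup>2)"
      if F: "finite F" "F \<subseteq> K" for F
    proof -
      have FI: "F \<subseteq> I" using F KI by auto
      obtain g where g: "\<And>i. i \<in> I \<Longrightarrow> cinner g (v i) = (if i \<in> F then x i else 0)"
        "\<And>i. i \<in> I \<Longrightarrow> cinner g (w i) = (\<Sum>j\<in>F. cnj (A j i) * x j)"
        by (rule finitely_supported_coefficients[OF v A F(1) FI]) (rule that)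
      have "ell2_norm I (\<lambda>i. cinner (f - g) (v i)) = ell2_norm I (\<lambda>i. if i \<in> I - F then x i else 0)"
        by (rule ell2_norm_cong) (auto simp: cinner_diff_left g x_def)
      also have "\<dots> = ell2_norm (I - F) x"
        using ell2_mono[OF x] by (intro ell2_cutoff(2)) auto
      finally have "a * (norm (f - g))\<^sup>2 \<le> (ell2_norm (I - F) x)\<^sup>2" using va[of "f - g"] by simp
      also have "\<dots> = R\<^sup>2 + (ell2_norm (K - F) x)\<^sup>2"
      proof -
        have "J \<subseteq> I - F" "I - F - J = K - F" using F J by (auto simp: K_def)
        then show ?thesis
          using ell2_norm_split[of x "I - F" J] ell2_mono[OF x, of "I - F"] by (simp add: R_def)
      qed
      finally have "(norm (f - g))\<^sup>2 \<le> (R\<^sup>2 + (ell2_norm (K - F) x)\<^sup>2) / a"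
        using a by (simp add: field_simps)
      then have fg: "norm (f - g) \<le> sqrt ((R\<^sup>2 + (ell2_norm (K - F) x)\<^sup>2) / a)"
        by (rule real_le_rsqrt)
      have "matrix_lower F (\<lambda>i j. cnj (A j i)) s"
        by (rule matrix_lower_adjoint[OF F(1) s lower[OF F(1) FI]])
      then have "s * L2_set (\<lambda>i. cmod (x i)) F \<le> L2_set (\<lambda>i. cmod (\<Sum>j\<in>F. cnj (A j i) * x j)) F"
        by (simp add: matrix_lower_def)
      also have "\<dots> = L2_set (\<lambda>i. cmod (y i + - cinner (f - g) (w i))) F"
        by (rule L2_set_cong) (use FI in \<open>auto simp: y_def cinner_diff_left g(2)\<close>)
      also have "\<dots> \<le> L2_set (\<lambda>i. cmod (y i)) F + L2_set (\<lambda>i. cmod (- cinner (f - g) (w i))) F"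
        by (rule L2_set_cmod_add_le)
      also have "\<dots> \<le> P + sqrt b' * norm (f - g)"
        using ell2_finite_sum_le[OF yK F] bessel_L2_set_le[OF b' F(1) FI, of "f - g"]
        by (intro add_mono) (auto simp: L2_set_le_iff nonneg P_def ell2_norm_nonneg)
      also have "\<dots> \<le> P + sqrt b' * sqrt ((R\<^sup>2 + (ell2_norm (K - F) x)\<^sup>2) / a)"
        using fg b0 by (intro add_left_mono mult_left_mono) auto
      also have "\<dots> = P + d * sqrt (R\<^sup>2 + (ell2_norm (K - F) x)\<^sup>2)"
        by (simp add: d_def real_sqrt_divide)
      finally show ?thesis .
    qed
    then have "s * ell2_norm K x \<le> P + d * R"
      by (rule lower_bound_limit[OF xK nonneg(1)])
    also have "\<dots> \<le> T + d * T"
      using PT RT d by (intro add_mono mult_left_mono) auto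
    finally have "ell2_norm K x \<le> (1 + d) / s * T"
      using s by (simp add: field_simps)
    then have "(ell2_norm K x)\<^sup>2 \<le> ((1 + d) / s)\<^sup>2 * T\<^sup>2"
      unfolding power_mult_distrib[symmetric] by (intro power_mono ell2_norm_nonneg)
    moreover have "R\<^sup>2 \<le> T\<^sup>2" using RT nonneg by (intro power_mono) auto
    moreover have "a * (norm f)\<^sup>2 \<le> R\<^sup>2 + (ell2_norm K x)\<^sup>2"
      using va[of f] ell2_norm_split[OF x J] by (simp add: x_def[symmetric] R_def K_def)
    ultimately have "a * (norm f)\<^sup>2 \<le> q * T\<^sup>2"
      by (simp add: q_def distrib_right)
    then show ?thesis using q by (simp add: T_def field_simps)
  qed
  then show ?thesis
    using a q bessel_weaving[OF b b'] by (intro frameI[of "a / q"]) auto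
qed

theorem theorem3p3:
  fixes I :: "'i set"
    and v w :: "'i \<Rightarrow> 'a::complex_hilbert_space"
    and A :: "'i \<Rightarrow> 'i \<Rightarrow> complex"
  assumes "separable_space (euclidean :: 'a topology)"
    and "countable I"
    and "is_riesz_basis I v"
    and "is_riesz_basis I w"
    and "is_change_of_basis_matrix I v w A"
  shows "woven I v w \<longleftrightarrow> central_submatrices_unif_bdd_invertible I A"
proof -
  have v: "is_frame I v" and w: "is_frame I w"
    using assms(3,4) by (simp_all add: is_riesz_basis_def)
  obtain b where b: "bessel I w b" using frame_bounds[OF w] by metis
  have woven_iff: "woven I v w \<longleftrightarrow> (\<forall>J\<subseteq>I. is_frame I (weaving J v w))"
    using v w by (simp add: woven_def weaving_def)
  show ?thesis
  proof
    assume "woven I v w"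
    then have "\<exists>c>0. \<forall>J\<subseteq>I. \<forall>f. c * (norm f)\<^sup>2 \<le> (ell2_norm I (\<lambda>i. cinner f (weaving J v w i)))\<^sup>2"
      by (intro weaving_uniform_lower_bound[OF assms(2) v w]) (simp add: woven_iff)
    then obtain c where c: "0 < c"
      "\<And>J f. J \<subseteq> I \<Longrightarrow> c * (norm f)\<^sup>2 \<le> (ell2_norm I (\<lambda>i. cinner f (weaving J v w i)))\<^sup>2"
      by blast
    obtain s where "0 < s" "\<And>K. finite K \<Longrightarrow> K \<subseteq> I \<Longrightarrow> matrix_lower K A s"
      by (rule woven_finite_submatrices_lower[OF assms(3,5) c]) (assumption | rule that)+
    then show "central_submatrices_unif_bdd_invertible I A"
      by (rule finite_submatrices_lower_imp_unif[OF assms(3) b assms(5)])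
  next
    assume "central_submatrices_unif_bdd_invertible I A"
    then obtain s where s: "0 < s" "\<And>K. finite K \<Longrightarrow> K \<subseteq> I \<Longrightarrow> matrix_lower K A s"
      by (rule unif_imp_finite_submatrices_lower) (rule that)
    show "woven I v w"
      unfolding woven_iff
      using finite_submatrices_lower_imp_frame[OF assms(3) w assms(5) s] by blast
  qed
qed

end
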